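(* Let $G$ be an $n$-dimensional torus, let $\Gamma$ be a finite $d$-valent graph with vertex set $V$ equipped with a GKM action of $G$ with edge weights $\alpha_e$, and let $f\in K_G(\Gamma)$. Then the sum $$\chi(f)=\sum_{p\in V} f_p\prod_{i(e)=p}\bigl(1-e^{2\pi i\alpha_e}\bigr)^{-1},$$ a priori an element of the field of fractions of $R(G)$, is an element of $R(G)$.
   Context: Torus notation. $\mathfrak g$ is the Lie algebra of $G$, $\mathbb Z_G=\ker(\exp:\mathfrak g\to G)$, and $\mathbb Z_G^*=\{\alpha\in\mathfrak g^*:\alpha(v)\in\mathbb Z\text{ for all }v\in\mathbb Z_G\}$ is the weight lattice. For $\alpha\in\mathbb Z_G^*$, $e^{2\pi i\alpha}:G\to S^1$ is the character $\exp(x)\mapsto e^{2\pi i\alpha(x)}$. For a compact commutative Lie group $H$, $R(H)$ is the representation ring, identified with the character ring: all finite sums $\sum m_k\chi_k$ with $m_k\in\mathbb Z$ and $\chi_k:H\to S^1$ characters. Graph and action. $E$ is the set of oriented edges of $\Gamma$ (each unoriented edge gives two oriented edges). For $e\in E$, $i(e)$ and $t(e)$ are its initial and terminal vertices and $\bar e$ is $e$ with reversed orientation. $d$-valent means each vertex $p$ has exactly $d$ oriented edges $e$ with $i(e)=p$. An action of $G$ on $\Gamma$ assigns to each $e\in E$ a one-dimensional representation $\varrho_e$ with character $\chi_e=e^{2\pi i\alpha_e}$, $\alpha_e\in\mathbb Z_G^*$, and to each $p\in V$ a $d$-dimensional representation $\tau_p$, such that, with $G_e=\ker\chi_e$: $\tau_p\simeq\bigoplus_{i(e)=p}\varrho_e$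 for all $p$; $\varrho_{\bar e}\simeq\varrho_e^*$ (so $\alpha_{\bar e}=-\alpha_e$); and $\tau_{i(e)}|_{G_e}\simeq\tau_{t(e)}|_{G_e}$ for all $e$. The action is GKM if for any two distinct oriented edges $e_1\ne e_2$ with $i(e_1)=i(e_2)$ the weights $\alpha_{e_1},\alpha_{e_2}$ are linearly independent. It is also assumed that $\alpha_e\neq0$ for all $e$ (automatic if $d\ge2$), so that the fractions make sense. $K_G(\Gamma)$ is the set of functions $f:V\to R(G)$, $p\mapsto f_p$, with $r_e f_{i(e)}=r_e f_{t(e)}$ for every edge $e$, where $r_e:R(G)\to R(G_e)$ is restriction. *)

theory Defs
  imports
    "HOL-Analysis.Abstract_Topology"
    "HOL-Analysis.Bounded_Linear_Function"
    "HOL-Algebra.Ring"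
    "HOL-Algebra.Coset"
    "Graph_Theory.Bidirected_Digraph"
    "Jordan_Normal_Form.Matrix"
begin

section \<open>Tori\<close>

text \<open>
  An \<open>n\<close>-dimensional torus is presented as the quotient of its Lie algebra \<open>'v\<close>, an
  \<open>n\<close>-dimensional real vector space, by the exponential map: \<open>ex\<close> is a surjective
  homomorphism whose kernel is a full lattice, and \<open>G\<close> carries the quotient topology \<open>T\<close>.
  The class \<open>real_normed_vector\<close> (rather than \<open>euclidean_space\<close>) keeps the case \<open>n = 0\<close>.
\<close>

locale torus = comm_group G
  for G (structure) +
  fixes T :: "'g topology"
    and ex :: "'v::real_normed_vector \<Rightarrow> 'g"
    and n :: nat
  assumes ex_range: "range ex = carrier G"
    and ex_add: "ex (x + y) = ex x \<otimes> ex y"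
    and ex_quotient: "quotient_map euclidean T ex"
    and ex_kernel: "\<exists>B. finite B \<and> card B = n \<and> independent B \<and> span B = UNIV \<and>
      {x. ex x = \<one>} = {\<Sum>b\<in>B. of_int (k b) *\<^sub>R b | k :: 'v \<Rightarrow> int. True}"

definition integral_lattice :: "('g, 'm) monoid_scheme \<Rightarrow> ('v \<Rightarrow> 'g) \<Rightarrow> 'v set" where
  "integral_lattice G ex = {x. ex x = \<one>\<^bsub>G\<^esub>}"

text \<open>
  The dual of the finite-dimensional space \<open>'v\<close> is the library type \<open>'v \<Rightarrow>\<^sub>L real\<close>; on a
  finite-dimensional space every linear functional is bounded.
\<close>

definition weight_lattice ::
  "('g, 'm) monoid_scheme \<Rightarrow> ('v::real_normed_vector \<Rightarrow> 'g) \<Rightarrow> ('v \<Rightarrow>\<^sub>L real) set" where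
  "weight_lattice G ex = {\<alpha>. \<forall>v\<in>integral_lattice G ex. blinfun_apply \<alpha> v \<in> \<int>}"

text \<open>
  The character \<open>exp x \<mapsto> exp (2 \<pi> i \<alpha>(x))\<close>. The described value is unique for \<open>\<alpha>\<close> in the
  weight lattice.
\<close>

definition weight_char ::
  "('g, 'm) monoid_scheme \<Rightarrow> ('v::real_normed_vector \<Rightarrow> 'g) \<Rightarrow> ('v \<Rightarrow>\<^sub>L real) \<Rightarrow> 'g \<Rightarrow> complex" where
  "weight_char G ex \<alpha> = (\<lambda>g\<in>carrier G.
     THE z. \<exists>x. ex x = g \<and> z = exp (2 * of_real pi * \<i> * of_real (blinfun_apply \<alpha> x)))"


section \<open>Characters and the representation ring\<close>

definition circle_group :: "complex monoid" where
  "circle_group = \<lparr>carrier = sphere 0 1, mult = (*), one = 1\<rparr>"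

text \<open>
  Here and below a topological group is a monoid record \<open>H\<close> with a topology \<open>T\<close> on its
  carrier. Functions on \<open>H\<close> are normalised to be \<open>extensional\<close>, so that equality of
  functions on \<open>H\<close> is equality in HOL.
\<close>

definition characters :: "('g, 'm) monoid_scheme \<Rightarrow> 'g topology \<Rightarrow> ('g \<Rightarrow> complex) set" where
  "characters H T = {\<psi> \<in> extensional (carrier H).
     \<psi> \<in> hom H circle_group \<and> continuous_map T (top_of_set (sphere 0 1)) \<psi>}"

definition rep_ring :: "('g, 'm) monoid_scheme \<Rightarrow> 'g topology \<Rightarrow> ('g \<Rightarrow> complex) ring" where
  "rep_ring H T =
     \<lparr>carrier = {(\<lambda>g\<in>carrier H. \<Sum>\<psi>\<in>C. of_int (m \<psi>) * \<psi> g) | C m :: ('g \<Rightarrow> complex) \<Rightarrow> int.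
                   finite C \<and> C \<subseteq> characters H T},
      mult = (\<lambda>a b. \<lambda>g\<in>carrier H. a g * b g),
      one = (\<lambda>g\<in>carrier H. 1),
      zero = (\<lambda>g\<in>carrier H. 0),
      add = (\<lambda>a b. \<lambda>g\<in>carrier H. a g + b g)\<rparr>"


section \<open>Finite-dimensional complex representations\<close>

definition representation ::
  "('g, 'm) monoid_scheme \<Rightarrow> 'g topology \<Rightarrow> nat \<Rightarrow> ('g \<Rightarrow> complex mat) \<Rightarrow> bool" where
  "representation H T d \<rho> \<longleftrightarrow>
     \<rho> \<in> hom H (units_of (ring_mat TYPE(complex) d ())) \<and>
     (\<forall>i<d. \<forall>j<d. continuous_map T euclidean (\<lambda>g. \<rho> g $$ (i, j)))"

text \<open>
  Isomorphism of the restrictions of two \<open>d\<close>-dimensional representations to the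
  subgroup with underlying set \<open>S\<close>.
\<close>

definition rep_iso_on ::
  "'g set \<Rightarrow> nat \<Rightarrow> ('g \<Rightarrow> complex mat) \<Rightarrow> ('g \<Rightarrow> complex mat) \<Rightarrow> bool" where
  "rep_iso_on S d \<rho> \<sigma> \<longleftrightarrow>
     (\<exists>P \<in> Units (ring_mat TYPE(complex) d ()). \<forall>g\<in>S. P * \<rho> g = \<sigma> g * P)"

definition direct_sum_rep :: "('g \<Rightarrow> complex mat) list \<Rightarrow> 'g \<Rightarrow> complex mat" where
  "direct_sum_rep \<rho>s = (\<lambda>g. diag_block_mat (map (\<lambda>\<rho>. \<rho> g) \<rho>s))"

definition dual_rep ::
  "('g, 'm) monoid_scheme \<Rightarrow> ('g \<Rightarrow> complex mat) \<Rightarrow> 'g \<Rightarrow> complex mat" where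
  "dual_rep H \<rho> = (\<lambda>g. transpose_mat (\<rho> (inv\<^bsub>H\<^esub> g)))"


section \<open>Torus actions on graphs\<close>

text \<open>
  \<open>arcs \<Gamma>\<close> is the set of oriented edges, \<open>tail\<close> and \<open>head\<close> give the initial and terminal
  vertices, and \<open>rev\<close> is the fixed-point-free orientation reversal; outside \<open>arcs \<Gamma>\<close> the
  locale \<open>bidirected_digraph\<close> normalises \<open>rev\<close> to the identity.
\<close>

locale torus_graph_action =
  torus G T ex n + fin_digraph \<Gamma> + bidirected_digraph \<Gamma> rev
  for G :: "('g, 'm) monoid_scheme"
    and T :: "'g topology"
    and ex :: "'v::real_normed_vector \<Rightarrow> 'g"
    and n :: nat
    and \<Gamma> :: "('p, 'e) pre_digraph"
    and rev :: "'e \<Rightarrow> 'e" +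
  fixes d :: nat
    and \<alpha> :: "'e \<Rightarrow> 'v \<Rightarrow>\<^sub>L real"
    and \<rho> :: "'e \<Rightarrow> 'g \<Rightarrow> complex mat"
    and \<tau> :: "'p \<Rightarrow> 'g \<Rightarrow> complex mat"
  assumes valent: "p \<in> verts \<Gamma> \<Longrightarrow> card (out_arcs \<Gamma> p) = d"
    and rho_rep: "e \<in> arcs \<Gamma> \<Longrightarrow> representation G T 1 (\<rho> e)"
    and weight: "e \<in> arcs \<Gamma> \<Longrightarrow> \<alpha> e \<in> weight_lattice G ex"
    and rho_char: "e \<in> arcs \<Gamma> \<Longrightarrow> g \<in> carrier G \<Longrightarrow> \<rho> e g $$ (0, 0) = weight_char G ex (\<alpha> e) g"
    and tau_rep: "p \<in> verts \<Gamma> \<Longrightarrow> representation G T d (\<tau> p)"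
    and tau_iso: "p \<in> verts \<Gamma> \<Longrightarrow> \<exists>es. distinct es \<and> set es = out_arcs \<Gamma> p \<and>
      rep_iso_on (carrier G) d (\<tau> p) (direct_sum_rep (map \<rho> es))"
    and rho_rev: "e \<in> arcs \<Gamma> \<Longrightarrow> rep_iso_on (carrier G) 1 (\<rho> (rev e)) (dual_rep G (\<rho> e))"
    and tau_edge: "e \<in> arcs \<Gamma> \<Longrightarrow>
      rep_iso_on (kernel G circle_group (weight_char G ex (\<alpha> e))) d
        (\<tau> (tail \<Gamma> e)) (\<tau> (head \<Gamma> e))"

locale GKM_graph_action = torus_graph_action +
  assumes gkm: "\<lbrakk>e1 \<in> arcs \<Gamma>; e2 \<in> arcs \<Gamma>; e1 \<noteq> e2; tail \<Gamma> e1 = tail \<Gamma> e2\<rbrakk> \<Longrightarrow>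
      \<alpha> e1 \<noteq> \<alpha> e2 \<and> independent {\<alpha> e1, \<alpha> e2}"
    and weight_nonzero: "e \<in> arcs \<Gamma> \<Longrightarrow> \<alpha> e \<noteq> 0"

definition K_class :: "('g, 'm) monoid_scheme \<Rightarrow> 'g topology \<Rightarrow> ('v::real_normed_vector \<Rightarrow> 'g) \<Rightarrow>
  ('p, 'e) pre_digraph \<Rightarrow> ('e \<Rightarrow> 'v \<Rightarrow>\<^sub>L real) \<Rightarrow> ('p \<Rightarrow> 'g \<Rightarrow> complex) set" where
  "K_class G T ex \<Gamma> \<alpha> = {f \<in> verts \<Gamma> \<rightarrow>\<^sub>E carrier (rep_ring G T).
     \<forall>e\<in>arcs \<Gamma>.
       restrict (f (tail \<Gamma> e)) (kernel G circle_group (weight_char G ex (\<alpha> e))) =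
       restrict (f (head \<Gamma> e)) (kernel G circle_group (weight_char G ex (\<alpha> e)))}"


section \<open>Fields of fractions\<close>

text \<open>\<open>K\<close>, with the embedding \<open>\<iota>\<close>, is a field of fractions of \<open>R\<close>.\<close>

definition is_fraction_field ::
  "('a, 'r) ring_scheme \<Rightarrow> ('k, 's) ring_scheme \<Rightarrow> ('a \<Rightarrow> 'k) \<Rightarrow> bool" where
  "is_fraction_field R K \<iota> \<longleftrightarrow>
     field K \<and> \<iota> \<in> ring_hom R K \<and> inj_on \<iota> (carrier R) \<and>
     (\<forall>x\<in>carrier K. \<exists>a\<in>carrier R. \<exists>b\<in>carrier R - {\<zero>\<^bsub>R\<^esub>}. x = \<iota> a \<otimes>\<^bsub>K\<^esub> inv\<^bsub>K\<^esub> (\<iota> b))"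

text \<open>The sum \<open>\<chi>(f)\<close>, formed in the field of fractions \<open>K\<close> of \<open>R(G)\<close>.\<close>

definition K_char :: "('g, 'm) monoid_scheme \<Rightarrow> 'g topology \<Rightarrow> ('v::real_normed_vector \<Rightarrow> 'g) \<Rightarrow>
  ('p, 'e) pre_digraph \<Rightarrow> ('e \<Rightarrow> 'v \<Rightarrow>\<^sub>L real) \<Rightarrow>
  ('k, 's) ring_scheme \<Rightarrow> (('g \<Rightarrow> complex) \<Rightarrow> 'k) \<Rightarrow> ('p \<Rightarrow> 'g \<Rightarrow> complex) \<Rightarrow> 'k" where
  "K_char G T ex \<Gamma> \<alpha> K \<iota> f =
     (\<Oplus>\<^bsub>K\<^esub> p \<in> verts \<Gamma>. \<iota> (f p) \<otimes>\<^bsub>K\<^esub>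
        (\<Otimes>\<^bsub>K\<^esub> e \<in> out_arcs \<Gamma> p.
           inv\<^bsub>K\<^esub> (\<iota> (\<one>\<^bsub>rep_ring G T\<^esub> \<ominus>\<^bsub>rep_ring G T\<^esub> weight_char G ex (\<alpha> e)))))"

end

theory Submission
  imports Defs "HOL-Analysis.Further_Topology" "Jordan_Normal_Form.Char_Poly"
begin

text \<open>
  Characters are pulled back along the exponential map, so that the representation ring becomes
  the ring of integral trigonometric polynomials on the Lie algebra. Let \<open>N\<close> be the numerator of
  \<open>\<chi>(f)\<close> over the common denominator \<open>D\<close>, the product of the factors
  \<open>1 - e\<^sup>2\<^sup>\<pi>\<^sup>i\<^sup>\<alpha>\<close> over all oriented edges. Fix the line through one weight \<open>\<beta>\<close>. At each
  vertex at most one edge has its weight on this line, so orientation reversal pairs off the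
  vertices carrying such an edge. For a pair joined by \<open>e\<close>, the congruences for \<open>f\<close> and for the
  isotropy representations modulo \<open>1 - e\<^sup>2\<^sup>\<pi>\<^sup>i\<^sup>\<alpha>\<close>, \<open>\<alpha>\<close> the weight of \<open>e\<close>, cancel this factor in
  the sum of the two local terms. Hence \<open>\<chi>(f)\<close> can be written with factors in the denominator
  that all come from other lines, and these do not vanish identically on any component of
  \<open>ker e\<^sup>2\<^sup>\<pi>\<^sup>i\<^sup>\<beta>\<close>. A trigonometric polynomial vanishing on that kernel is a multiple of
  \<open>1 - e\<^sup>2\<^sup>\<pi>\<^sup>i\<^sup>\<beta>\<close>, by linear independence of characters, so the factors of \<open>D\<close> can be split off
  from \<open>N\<close> one after the other.
\<close>

section \<open>Integral combinations of characters\<close>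

text \<open>Same shape as the carrier of \<open>rep_ring\<close>, without the normalisation outside
  a carrier. When \<open>\<Psi>\<close> is \<open>unitary_chars\<close> of the integral lattice,
  this is R(G) pulled back to the Lie algebra, see \<open>rep_ring_iff\<close>.\<close>

definition int_span :: "('a \<Rightarrow> complex) set \<Rightarrow> ('a \<Rightarrow> complex) set" where
  "int_span \<Psi> = {(\<lambda>x. \<Sum>\<psi>\<in>C. of_int (m \<psi>) * \<psi> x) | C m :: ('a \<Rightarrow> complex) \<Rightarrow> int.
     finite C \<and> C \<subseteq> \<Psi>}"

lemma int_spanI:
  "finite C \<Longrightarrow> C \<subseteq> \<Psi> \<Longrightarrow> (\<lambda>x. \<Sum>\<psi>\<in>C. of_int (m \<psi>) * \<psi> x) \<in> int_span \<Psi>"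
  for m :: "('a \<Rightarrow> complex) \<Rightarrow> int"
  unfolding int_span_def by blast

lemma int_spanE:
  assumes "h \<in> int_span \<Psi>"
  obtains C and m :: "('a \<Rightarrow> complex) \<Rightarrow> int" where "finite C" "C \<subseteq> \<Psi>"
    "h = (\<lambda>x. \<Sum>\<psi>\<in>C. of_int (m \<psi>) * \<psi> x)"
  using assms unfolding int_span_def by blast

lemma int_span_zero: "(\<lambda>x. 0) \<in> int_span \<Psi>"
  using int_spanI[of "{}" \<Psi>] by simp

lemma int_span_scaled: "\<psi> \<in> \<Psi> \<Longrightarrow> (\<lambda>x. of_int k * \<psi> x) \<in> int_span \<Psi>"
  using int_spanI[of "{\<psi>}" \<Psi> "\<lambda>_. k"] by simp

lemma int_span_base: "\<psi> \<in> \<Psi> \<Longrightarrow> \<psi> \<in> int_span \<Psi>"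
  using int_span_scaled[of \<psi> \<Psi> 1] by simp

lemma int_span_add:
  assumes "a \<in> int_span \<Psi>" "b \<in> int_span \<Psi>"
  shows "(\<lambda>x. a x + b x) \<in> int_span \<Psi>"
proof -
  obtain C m where C: "finite C" "C \<subseteq> \<Psi>" "a = (\<lambda>x. \<Sum>\<psi>\<in>C. of_int (m \<psi>) * \<psi> x)"
    using assms(1) by (rule int_spanE)
  obtain D k where D: "finite D" "D \<subseteq> \<Psi>" "b = (\<lambda>x. \<Sum>\<psi>\<in>D. of_int (k \<psi>) * \<psi> x)"
    using assms(2) by (rule int_spanE)
  define l where "l \<psi> = (if \<psi> \<in> C then m \<psi> else 0) + (if \<psi> \<in> D then k \<psi> else 0)" for \<psi>
  have "a x + b x = (\<Sum>\<psi>\<in>C \<union> D. of_int (l \<psi>) * \<psi> x)" for x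
  proof -
    have "a x = (\<Sum>\<psi>\<in>C \<union> D. of_int (if \<psi> \<in> C then m \<psi> else 0) * \<psi> x)"
      unfolding C(3) using C(1) D(1) by (intro sum.mono_neutral_cong_left) auto
    moreover have "b x = (\<Sum>\<psi>\<in>C \<union> D. of_int (if \<psi> \<in> D then k \<psi> else 0) * \<psi> x)"
      unfolding D(3) using C(1) D(1) by (intro sum.mono_neutral_cong_left) auto
    ultimately show ?thesis
      by (simp only: l_def of_int_add distrib_right sum.distrib)
  qed
  then have "(\<lambda>x. a x + b x) = (\<lambda>x. \<Sum>\<psi>\<in>C \<union> D. of_int (l \<psi>) * \<psi> x)" by blast
  then show ?thesis using C D int_spanI[of "C \<union> D" \<Psi> l] by simp
qed

lemma int_span_sum:
  assumes "\<And>i. i \<in> I \<Longrightarrow> a i \<in> int_span \<Psi>"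
  shows "(\<lambda>x. \<Sum>i\<in>I. a i x) \<in> int_span \<Psi>"
  using assms by (induction I rule: infinite_finite_induct) (auto intro: int_span_zero int_span_add)

lemma int_span_uminus:
  assumes "a \<in> int_span \<Psi>"
  shows "(\<lambda>x. - a x) \<in> int_span \<Psi>"
proof -
  obtain C m where C: "finite C" "C \<subseteq> \<Psi>" "a = (\<lambda>x. \<Sum>\<psi>\<in>C. of_int (m \<psi>) * \<psi> x)"
    using assms by (rule int_spanE)
  then have "(\<lambda>x. - a x) = (\<lambda>x. \<Sum>\<psi>\<in>C. of_int (- m \<psi>) * \<psi> x)"
    by (simp add: sum_negf)
  then show ?thesis using C int_spanI[of C \<Psi> "\<lambda>\<psi>. - m \<psi>"] by simp
qed

lemma int_span_diff:
  "a \<in> int_span \<Psi> \<Longrightarrow> b \<in> int_span \<Psi> \<Longrightarrow> (\<lambda>x. a x - b x) \<in> int_span \<Psi>"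
  using int_span_add[OF _ int_span_uminus] by simp

lemma int_span_mult:
  assumes closed: "\<And>\<phi> \<psi>. \<phi> \<in> \<Psi> \<Longrightarrow> \<psi> \<in> \<Psi> \<Longrightarrow> (\<lambda>x. \<phi> x * \<psi> x) \<in> \<Psi>"
    and "a \<in> int_span \<Psi>" "b \<in> int_span \<Psi>"
  shows "(\<lambda>x. a x * b x) \<in> int_span \<Psi>"
proof -
  obtain C m where C: "C \<subseteq> \<Psi>" "a = (\<lambda>x. \<Sum>\<phi>\<in>C. of_int (m \<phi>) * \<phi> x)"
    using assms(2) by (rule int_spanE)
  obtain D k where D: "D \<subseteq> \<Psi>" "b = (\<lambda>x. \<Sum>\<psi>\<in>D. of_int (k \<psi>) * \<psi> x)"
    using assms(3) by (rule int_spanE)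
  have "(\<lambda>x. of_int (m \<phi>) * \<phi> x * (of_int (k \<psi>) * \<psi> x)) \<in> int_span \<Psi>"
    if "\<phi> \<in> C" "\<psi> \<in> D" for \<phi> \<psi>
  proof -
    have "(\<lambda>x. of_int (m \<phi> * k \<psi>) * (\<phi> x * \<psi> x)) \<in> int_span \<Psi>"
      by (intro int_span_scaled closed) (use that C(1) D(1) in auto)
    then show ?thesis by (simp add: mult_ac)
  qed
  then show ?thesis
    unfolding C(2) D(2) sum_product by (intro int_span_sum)
qed

section \<open>Characters of the Lie algebra and the ring they generate\<close>

text \<open>When \<open>L\<close> is the kernel of the exponential map, these are exactly the
  pullbacks of the characters of the torus, by \<open>character_comp_ex\<close> and
  \<open>unitary_char_descends\<close>.\<close>

definition unitary_chars :: "'v::real_normed_vector set \<Rightarrow> ('v \<Rightarrow> complex) set" where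
  "unitary_chars L = {\<theta>. continuous_on UNIV \<theta> \<and> (\<forall>x y. \<theta> (x + y) = \<theta> x * \<theta> y) \<and>
     (\<forall>x. cmod (\<theta> x) = 1) \<and> (\<forall>x\<in>L. \<theta> x = 1)}"

lemma unitary_chars_mult:
  "\<phi> \<in> unitary_chars L \<Longrightarrow> \<psi> \<in> unitary_chars L \<Longrightarrow> (\<lambda>x. \<phi> x * \<psi> x) \<in> unitary_chars L"
  unfolding unitary_chars_def by (auto intro!: continuous_intros simp: norm_mult)

lemma unitary_chars_one: "(\<lambda>x. 1) \<in> unitary_chars L"
  unfolding unitary_chars_def by auto

lemma unitary_chars_power:
  "\<phi> \<in> unitary_chars L \<Longrightarrow> (\<lambda>x. \<phi> x ^ n) \<in> unitary_chars L"
  by (induction n) (auto intro: unitary_chars_one unitary_chars_mult)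

lemma char_ring_mult:
  "a \<in> int_span (unitary_chars L) \<Longrightarrow> b \<in> int_span (unitary_chars L) \<Longrightarrow>
    (\<lambda>x. a x * b x) \<in> int_span (unitary_chars L)"
  by (rule int_span_mult[OF unitary_chars_mult])

lemma char_ring_one: "(\<lambda>x. 1) \<in> int_span (unitary_chars L)"
  by (intro int_span_base unitary_chars_one)

lemma char_ring_prod:
  assumes "\<And>i. i \<in> I \<Longrightarrow> a i \<in> int_span (unitary_chars L)"
  shows "(\<lambda>x. \<Prod>i\<in>I. a i x) \<in> int_span (unitary_chars L)"
  using assms
  by (induction I rule: infinite_finite_induct) (auto intro: char_ring_one char_ring_mult)

lemma char_ring_continuous:
  assumes "a \<in> int_span (unitary_chars L)"
  shows "continuous_on UNIV a"
proof -
  obtain C m where C: "C \<subseteq> unitary_chars L" "a = (\<lambda>x. \<Sum>\<psi>\<in>C. of_int (m \<psi>) * \<psi> x)"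
    using assms by (rule int_spanE)
  then have "continuous_on UNIV \<psi>" if "\<psi> \<in> C" for \<psi>
    using that unfolding unitary_chars_def by auto
  then show ?thesis unfolding C(2) by (intro continuous_intros)
qed

lemma cis_2pi_eq_1_iff: "cis (2 * pi * t) = 1 \<longleftrightarrow> t \<in> \<int>"
proof
  assume "cis (2 * pi * t) = 1"
  then have "cos (2 * pi * t) = 1"
    by (metis cis.simps(1) one_complex.simps(1))
  then obtain k :: int where "2 * pi * t = of_int k * 2 * pi"
    by (auto simp: cos_one_2pi_int)
  then have "t = of_int k" by simp
  then show "t \<in> \<int>" by simp
qed (auto elim!: Ints_cases)

lemma unitary_chars_cis:
  fixes \<gamma> :: "'v::real_normed_vector \<Rightarrow>\<^sub>L real"
  assumes "\<And>x. x \<in> L \<Longrightarrow> \<gamma> x \<in> \<int>"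
  shows "(\<lambda>x. cis (2 * pi * \<gamma> x)) \<in> unitary_chars L"
  using assms unfolding unitary_chars_def
  by (auto intro!: continuous_intros simp: blinfun.add_right distrib_left cis_mult[symmetric]
      cis_2pi_eq_1_iff)

text \<open>Dedekind's lemma, by the usual shortening of a dependence.\<close>

lemma characters_independent:
  fixes a :: "('v::plus \<Rightarrow> complex) \<Rightarrow> complex"
  assumes "finite C"
    and "\<And>x y. x \<in> S \<Longrightarrow> y \<in> S \<Longrightarrow> x + y \<in> S"
    and "\<And>\<psi> x y. \<psi> \<in> C \<Longrightarrow> x \<in> S \<Longrightarrow> y \<in> S \<Longrightarrow> \<psi> (x + y) = \<psi> x * \<psi> y"
    and "\<And>\<psi>. \<psi> \<in> C \<Longrightarrow> \<exists>x\<in>S. \<psi> x \<noteq> 0"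
    and "\<And>\<phi> \<psi>. \<phi> \<in> C \<Longrightarrow> \<psi> \<in> C \<Longrightarrow> (\<And>x. x \<in> S \<Longrightarrow> \<phi> x = \<psi> x) \<Longrightarrow> \<phi> = \<psi>"
    and "\<And>x. x \<in> S \<Longrightarrow> (\<Sum>\<psi>\<in>C. a \<psi> * \<psi> x) = 0"
    and "\<psi> \<in> C"
  shows "a \<psi> = 0"
  using assms
proof (induction C arbitrary: a \<psi> rule: finite_induct)
  case empty
  then show ?case by simp
next
  case (insert \<phi> C)
  have zero_C: "a \<psi> = 0" if "\<psi> \<in> C" for \<psi>
  proof -
    have "\<psi> \<noteq> \<phi>" using that insert.hyps by auto
    then have "\<not> (\<forall>y\<in>S. \<phi> y = \<psi> y)"
      using insert.prems(4)[of \<phi> \<psi>] that by auto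
    then obtain y where y: "y \<in> S" "\<phi> y \<noteq> \<psi> y" by blast
    \<comment> \<open>Subtracting \<open>\<phi> y\<close> times the relation at \<open>x\<close>
      from the relation at \<open>x + y\<close> removes \<open>\<phi>\<close> and leaves a shorter
      relation, to which the induction hypothesis applies.\<close>
    have eq: "(\<Sum>\<psi>\<in>C. (a \<psi> * (\<psi> y - \<phi> y)) * \<psi> x) = 0" if x: "x \<in> S" for x
    proof -
      have "a \<phi> * \<phi> (x + y) + (\<Sum>\<psi>\<in>C. a \<psi> * \<psi> (x + y)) = 0"
        using insert.prems(5)[of "x + y"] insert.prems(1)[OF x y(1)] insert.hyps by simp
      moreover have "(\<Sum>\<psi>\<in>C. a \<psi> * \<psi> (x + y)) = (\<Sum>\<psi>\<in>C. a \<psi> * \<psi> x * \<psi> y)"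
        using insert.prems(2) x y(1) by (intro sum.cong) auto
      moreover have "\<phi> (x + y) = \<phi> x * \<phi> y"
        using insert.prems(2) x y(1) by auto
      moreover have "(a \<phi> * \<phi> x + (\<Sum>\<psi>\<in>C. a \<psi> * \<psi> x)) * \<phi> y = 0"
        using insert.prems(5)[OF x] insert.hyps by simp
      ultimately have "a \<phi> * (\<phi> x * \<phi> y) + (\<Sum>\<psi>\<in>C. a \<psi> * \<psi> x * \<psi> y)
          = a \<phi> * (\<phi> x * \<phi> y) + (\<Sum>\<psi>\<in>C. a \<psi> * \<psi> x) * \<phi> y"
        by (simp only: distrib_right mult.assoc)
      then have "(\<Sum>\<psi>\<in>C. a \<psi> * \<psi> x * \<psi> y) - (\<Sum>\<psi>\<in>C. a \<psi> * \<psi> x) * \<phi> y = 0"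
        by simp
      moreover have "(\<Sum>\<psi>\<in>C. (a \<psi> * (\<psi> y - \<phi> y)) * \<psi> x)
          = (\<Sum>\<psi>\<in>C. a \<psi> * \<psi> x * \<psi> y) - (\<Sum>\<psi>\<in>C. a \<psi> * \<psi> x) * \<phi> y"
        unfolding sum_distrib_right sum_subtractf[symmetric]
        by (intro sum.cong) (auto simp: algebra_simps)
      ultimately show ?thesis by (simp only:)
    qed
    have "a \<psi> * (\<psi> y - \<phi> y) = 0"
      using insert.IH[OF insert.prems(1) insert.prems(2) insert.prems(3) insert.prems(4) eq that]
      by blast
    then show ?thesis using y by simp
  qed
  obtain x where x: "x \<in> S" "\<phi> x \<noteq> 0" using insert.prems(3) by blast
  have "a \<phi> * \<phi> x = 0"
    using insert.prems(5)[OF x(1)] insert.hyps zero_C by simp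
  then have "a \<phi> = 0" using x by simp
  then show ?case using zero_C insert.prems(6) by auto
qed

section \<open>Characters trivial on the kernel of one weight\<close>

text \<open>Additivity and \<open>u 1 = 0\<close> make \<open>u\<close> periodic with period 1,
  hence bounded, since it is bounded on [0, 1]. A nonzero value \<open>u t\<close> would make the
  values \<open>u (n * t) = n * u t\<close> unbounded.\<close>

lemma continuous_additive_real_eq_0:
  fixes u :: "real \<Rightarrow> complex"
  assumes cont: "continuous_on UNIV u" and add: "\<And>s t. u (s + t) = u s + u t" and "u 1 = 0"
  shows "u t = 0"
proof -
  have u0: "u 0 = 0" using add[of 0 0] by simp
  have u_nat: "u (of_nat n * s) = of_nat n * u s" for n s
    by (induction n) (auto simp: add u0 distrib_right)
  have u_int: "u (of_int k) = 0" for k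
  proof (cases k rule: int_cases2)
    case (nonneg n)
    then show ?thesis using u_nat[of n 1] assms(3) by simp
  next
    case (nonpos n)
    have "u (of_int k) + u (of_nat n) = 0"
      using add[of "of_int k" "of_nat n", symmetric] u0 nonpos by simp
    then show ?thesis using u_nat[of n 1] assms(3) by simp
  qed
  have "bounded (u ` {0..1})"
    using cont by (intro compact_imp_bounded compact_continuous_image)
      (auto intro: continuous_on_subset)
  then obtain B where "\<forall>z\<in>u ` {0..1}. cmod z \<le> B"
    unfolding bounded_iff by blast
  then have B: "cmod (u s) \<le> B" if "s \<in> {0..1}" for s
    using that by blast
  have bound: "cmod (u s) \<le> B" for s
  proof -
    have "u s = u (frac s) + u (of_int \<lfloor>s\<rfloor>)"
      unfolding add[symmetric] by (simp add: frac_def)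
    then show ?thesis using B[of "frac s"] frac_lt_1[of s] by (simp add: u_int)
  qed
  show ?thesis
  proof (rule ccontr)
    assume "u t \<noteq> 0"
    then obtain n :: nat where "B < of_nat n * cmod (u t)"
      using reals_Archimedean3[of "cmod (u t)"] by auto
    then show False using bound[of "of_nat n * t"] by (simp add: u_nat norm_mult)
  qed
qed

text \<open>The real line is contractible, so \<open>\<phi>\<close> has a continuous logarithm
  \<open>h\<close>, normalised by \<open>h 0 = 0\<close>. It is additive up to multiples of 2 pi i,
  hence additive by continuity, hence linear, and \<open>\<phi> 1 = 1\<close> forces its slope to be
  an integral multiple of 2 pi i.\<close>

lemma circle_character:
  fixes \<phi> :: "real \<Rightarrow> complex"
  assumes cont: "continuous_on UNIV \<phi>" and mult: "\<And>s t. \<phi> (s + t) = \<phi> s * \<phi> t"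
    and one: "\<phi> 1 = 1"
  shows "\<exists>k::int. \<forall>t. \<phi> t = cis (2 * pi * (of_int k * t))"
proof -
  have phi0: "\<phi> 0 = 1" using mult[of 0 1] one by simp
  have nz: "\<phi> t \<noteq> 0" for t using mult[of t "-t"] phi0 by auto
  obtain g where g: "continuous_on UNIV g" "\<And>t. \<phi> t = exp (g t)"
    using continuous_logarithm_on_contractible[OF cont] nz
    by (metis UNIV_I convex_UNIV convex_imp_contractible)
  define h where "h t = g t - g 0" for t
  have exp_h: "exp (h t) = \<phi> t" for t
    using g(2) phi0 by (simp add: h_def exp_diff)
  have cont_h: "continuous_on UNIV h"
    unfolding h_def by (intro continuous_intros g)
  have h_add: "h (s + t) = h s + h t" for s t
  proof -
    define D where "D t = h (s + t) - h s - h t" for t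
    have D: "D t \<in> range (\<lambda>k. of_int (2 * k) * (of_real pi * \<i>))" for t
    proof -
      have "exp (D t) = 1"
        by (simp add: D_def exp_diff exp_h mult nz)
      then show ?thesis unfolding exp_eq_1 by (auto simp: complex_eq_iff)
    qed
    have "D constant_on UNIV"
    proof (rule continuous_discrete_range_constant)
      show "continuous_on UNIV D"
        unfolding D_def by (intro continuous_intros continuous_on_compose2[OF cont_h]) auto
      fix t
      \<comment> \<open>Distinct multiples of 2 pi i are at least 2 pi apart, so the continuous
        function \<open>D\<close> has a discrete range and is constant.\<close>
      have "2 * pi \<le> cmod (D t' - D t)" if ne: "D t' \<noteq> D t" for t'
      proof -
        obtain j k where jk: "D t' = of_int (2 * j) * (of_real pi * \<i>)"
          "D t = of_int (2 * k) * (of_real pi * \<i>)" using D by blast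
        have eq: "D t' - D t = of_real (2 * pi * of_int (j - k)) * \<i>"
          by (simp add: jk algebra_simps)
        have "j \<noteq> k" using ne jk by auto
        then have "1 \<le> \<bar>j - k\<bar>" by linarith
        then have "1 \<le> \<bar>of_int (j - k) :: real\<bar>" by (metis of_int_1_le_iff of_int_abs)
        then show ?thesis
          unfolding eq norm_mult norm_of_real abs_mult by simp
      qed
      then show "\<exists>e>0. \<forall>y. y \<in> UNIV \<and> D y \<noteq> D t \<longrightarrow> e \<le> cmod (D y - D t)"
        by (intro exI[of _ "2 * pi"]) auto
    qed auto
    then have "D t = D 0" unfolding constant_on_def by auto
    also have "\<dots> = 0" by (simp add: D_def h_def)
    finally show ?thesis unfolding D_def diff_diff_add by simp
  qed
  obtain k :: int where k: "h 1 = of_real (2 * pi * of_int k) * \<i>"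
  proof -
    have "exp (h 1) = 1" by (simp add: exp_h one)
    then show ?thesis using that unfolding exp_eq_1 by (auto simp: complex_eq_iff)
  qed
  \<comment> \<open>Removing the linear function with the same value at 1 leaves a continuous
    additive function that vanishes at 1.\<close>
  have "h t - of_real t * h 1 = 0" for t
    by (rule continuous_additive_real_eq_0[where u = "\<lambda>t. h t - of_real t * h 1"])
      (auto intro!: continuous_intros cont_h simp: h_add algebra_simps)
  then have "h t = \<i> * of_real (2 * pi * (of_int k * t))" for t
    unfolding k by (simp add: algebra_simps)
  then have "\<phi> t = cis (2 * pi * (of_int k * t))" for t
    using exp_h[of t] by (simp add: cis_conv_exp)
  then show ?thesis by blast
qed

lemma blinfun_nonzero_obtain:
  fixes \<beta> :: "'v::real_normed_vector \<Rightarrow>\<^sub>L real"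
  assumes "\<beta> \<noteq> 0"
  obtains x where "\<beta> x = 1"
proof -
  obtain y where "\<beta> y \<noteq> 0" using assms by (metis blinfun_eqI zero_blinfun.rep_eq)
  then have "\<beta> (y /\<^sub>R \<beta> y) = 1" by (simp add: blinfun.scaleR_right)
  then show ?thesis using that by blast
qed

text \<open>Pick \<open>x1\<close> with \<open>\<beta> x1 = 1\<close> and write \<open>x\<close> as
  \<open>x - \<beta> x *\<^sub>R x1\<close> plus \<open>\<beta> x *\<^sub>R x1\<close>. The first
  summand is killed by \<open>\<beta>\<close>, so \<open>\<theta>\<close> is 1 there; on the line
  through \<open>x1\<close> the claim is \<open>circle_character\<close>, because
  \<open>\<theta> x1 = 1\<close>.\<close>

lemma unitary_char_trivial_on_kernel:
  fixes \<beta> :: "'v::real_normed_vector \<Rightarrow>\<^sub>L real"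
  assumes \<theta>: "\<theta> \<in> unitary_chars L" and "\<beta> \<noteq> 0" and triv: "\<And>x. \<beta> x \<in> \<int> \<Longrightarrow> \<theta> x = 1"
  shows "\<exists>k::int. \<forall>x. \<theta> x = cis (2 * pi * (of_int k * \<beta> x))"
proof -
  obtain x1 where x1: "\<beta> x1 = 1" using assms(2) blinfun_nonzero_obtain by blast
  have cont: "continuous_on UNIV \<theta>" and mult: "\<And>x y. \<theta> (x + y) = \<theta> x * \<theta> y"
    using \<theta> unfolding unitary_chars_def by auto
  have "\<exists>k::int. \<forall>t. \<theta> (t *\<^sub>R x1) = cis (2 * pi * (of_int k * t))"
    by (rule circle_character)
      (auto intro!: continuous_intros continuous_on_compose2[OF cont] triv
        simp: mult scaleR_add_left x1 blinfun.scaleR_right)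
  then obtain k :: int where k: "\<And>t. \<theta> (t *\<^sub>R x1) = cis (2 * pi * (of_int k * t))" by blast
  have "\<theta> x = cis (2 * pi * (of_int k * \<beta> x))" for x
  proof -
    have "\<theta> x = \<theta> (x - \<beta> x *\<^sub>R x1) * \<theta> (\<beta> x *\<^sub>R x1)"
      by (simp flip: mult)
    moreover have "\<theta> (x - \<beta> x *\<^sub>R x1) = 1"
      by (rule triv) (simp add: blinfun.diff_right blinfun.scaleR_right x1)
    ultimately show ?thesis by (simp add: k)
  qed
  then show ?thesis by blast
qed

text \<open>The quotient of the two characters is an integral power of e^{2 pi i \<beta>}. The
  disjunction moves a negative power to the other side, so that the exponent is a natural number and
  a geometric sum can be applied.\<close>

lemma unitary_chars_agree_on_kernel:
  fixes \<beta> :: "'v::real_normed_vector \<Rightarrow>\<^sub>L real"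
  assumes \<phi>: "\<phi> \<in> unitary_chars L" and \<psi>: "\<psi> \<in> unitary_chars L" and "\<beta> \<noteq> 0"
    and agree: "\<And>x. \<beta> x \<in> \<int> \<Longrightarrow> \<phi> x = \<psi> x"
  shows "\<exists>n::nat. (\<forall>x. \<phi> x = \<psi> x * cis (2 * pi * \<beta> x) ^ n) \<or>
    (\<forall>x. \<psi> x = \<phi> x * cis (2 * pi * \<beta> x) ^ n)"
proof -
  have nz: "\<phi> x \<noteq> 0" "\<psi> x \<noteq> 0" for x
    using \<phi> \<psi> unfolding unitary_chars_def by (metis (mono_tags, lifting) mem_Collect_eq norm_zero zero_neq_one)+
  have "(\<lambda>x. \<phi> x / \<psi> x) \<in> unitary_chars L"
    using \<phi> \<psi> nz unfolding unitary_chars_def by (auto intro!: continuous_intros simp: norm_divide)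
  then obtain k :: int where k: "\<And>x. \<phi> x / \<psi> x = cis (2 * pi * (of_int k * \<beta> x))"
    using unitary_char_trivial_on_kernel[where \<beta> = \<beta>] \<open>\<beta> \<noteq> 0\<close> agree nz by fastforce
  show ?thesis
  proof (cases k rule: int_cases2)
    case (nonneg n)
    have "\<phi> x = \<psi> x * cis (2 * pi * \<beta> x) ^ n" for x
      using k[of x] nz[of x] nonneg by (simp add: Complex.DeMoivre field_simps)
    then show ?thesis by blast
  next
    case (nonpos n)
    have "\<psi> x = \<phi> x * cis (2 * pi * \<beta> x) ^ n" for x
    proof -
      have "\<phi> x = \<psi> x * cis (- (2 * pi * (of_nat n * \<beta> x)))"
        using k[of x] nz[of x] nonpos by (simp add: field_simps)
      then show ?thesis
        by (simp add: Complex.DeMoivre cis_mult mult_ac)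
    qed
    then show ?thesis by blast
  qed
qed

text \<open>Sort the characters in \<open>h\<close> by their restriction to the set where
  \<open>\<beta>\<close> is integral, and replace each by a representative of its class. By a
  geometric sum, each replacement changes \<open>h\<close> by a multiple of the factor. The
  representatives are distinct on that set and their remaining combination vanishes there, so its
  coefficients are zero by \<open>characters_independent\<close>.\<close>

lemma char_ring_divisible:
  fixes \<beta> :: "'v::real_normed_vector \<Rightarrow>\<^sub>L real"
  assumes h: "h \<in> int_span (unitary_chars L)"
    and \<beta>: "(\<lambda>x. cis (2 * pi * \<beta> x)) \<in> unitary_chars L" "\<beta> \<noteq> 0"
    and vanish: "\<And>x. \<beta> x \<in> \<int> \<Longrightarrow> h x = 0"
  shows "\<exists>q\<in>int_span (unitary_chars L). \<forall>x. h x = (1 - cis (2 * pi * \<beta> x)) * q x"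
proof -
  let ?R = "int_span (unitary_chars L)"
  let ?E = "\<lambda>x. cis (2 * pi * \<beta> x)"
  obtain C m where C: "finite C" "C \<subseteq> unitary_chars L"
    and h_eq: "h = (\<lambda>x. \<Sum>\<psi>\<in>C. of_int (m \<psi>) * \<psi> x)"
    using h by (rule int_spanE)
  define r where "r \<psi> = (SOME \<phi>. \<phi> \<in> C \<and> (\<forall>x. \<beta> x \<in> \<int> \<longrightarrow> \<phi> x = \<psi> x))" for \<psi>
  have r: "r \<psi> \<in> C" "\<And>x. \<beta> x \<in> \<int> \<Longrightarrow> r \<psi> x = \<psi> x" if "\<psi> \<in> C" for \<psi>
  proof -
    have "r \<psi> \<in> C \<and> (\<forall>x. \<beta> x \<in> \<int> \<longrightarrow> r \<psi> x = \<psi> x)"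
      unfolding r_def by (rule someI[of _ \<psi>]) (use that in auto)
    then show "r \<psi> \<in> C" "\<And>x. \<beta> x \<in> \<int> \<Longrightarrow> r \<psi> x = \<psi> x" by auto
  qed
  \<comment> \<open>The predicate under the choice depends only on the values where
    \<open>\<beta>\<close> is integral, so \<open>r\<close> picks one representative for a whole
    class.\<close>
  have r_eq: "r \<phi> = r \<psi>" if "\<And>x. \<beta> x \<in> \<int> \<Longrightarrow> \<phi> x = \<psi> x" for \<phi> \<psi>
    unfolding r_def using that by (intro arg_cong[where f = Eps]) auto
  have geom: "\<exists>q\<in>?R. \<forall>x. \<psi> x * ?E x ^ n - \<psi> x = (1 - ?E x) * q x"
    if "\<psi> \<in> unitary_chars L" for \<psi> n
  proof (intro bexI allI)
    show "(\<lambda>x. - (\<psi> x * (\<Sum>i<n. ?E x ^ i))) \<in> ?R"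
      by (intro int_span_uminus char_ring_mult int_span_sum int_span_base unitary_chars_power \<beta> that)
    show "\<psi> x * ?E x ^ n - \<psi> x = (1 - ?E x) * - (\<psi> x * (\<Sum>i<n. ?E x ^ i))" for x
    proof -
      have "(1 - ?E x) * - (\<psi> x * (\<Sum>i<n. ?E x ^ i)) = - (\<psi> x * ((1 - ?E x) * (\<Sum>i<n. ?E x ^ i)))"
        by (simp only: mult_minus_right mult.left_commute)
      then show ?thesis
        unfolding one_diff_power_eq[symmetric] by (simp add: algebra_simps)
    qed
  qed
  have "\<exists>q\<in>?R. \<forall>x. \<psi> x - r \<psi> x = (1 - ?E x) * q x" if "\<psi> \<in> C" for \<psi>
  proof -
    have ch: "\<psi> \<in> unitary_chars L" "r \<psi> \<in> unitary_chars L" using r that C by auto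
    have "\<And>x. \<beta> x \<in> \<int> \<Longrightarrow> \<psi> x = r \<psi> x" using r(2)[OF that] by simp
    then obtain n where "(\<forall>x. \<psi> x = r \<psi> x * ?E x ^ n) \<or> (\<forall>x. r \<psi> x = \<psi> x * ?E x ^ n)"
      using unitary_chars_agree_on_kernel[OF ch \<beta>(2)] by blast
    then show ?thesis
    proof
      assume "\<forall>x. \<psi> x = r \<psi> x * ?E x ^ n"
      then show ?thesis using geom[OF ch(2), of n] by simp
    next
      assume *: "\<forall>x. r \<psi> x = \<psi> x * ?E x ^ n"
      obtain q where q: "q \<in> ?R" "\<forall>x. \<psi> x * ?E x ^ n - \<psi> x = (1 - ?E x) * q x"
        using geom[OF ch(1), of n] by blast
      have "\<psi> x - r \<psi> x = (1 - ?E x) * - q x" for x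
      proof -
        have "\<psi> x - r \<psi> x = - (\<psi> x * ?E x ^ n - \<psi> x)" using * by simp
        also have "\<dots> = (1 - ?E x) * - q x" unfolding q(2)[rule_format] by simp
        finally show "\<psi> x - r \<psi> x = (1 - ?E x) * - q x" .
      qed
      then show ?thesis
        by (intro bexI[of _ "\<lambda>x. - q x"] allI int_span_uminus[OF q(1)])
    qed
  qed
  then obtain q where q: "\<And>\<psi>. \<psi> \<in> C \<Longrightarrow> q \<psi> \<in> ?R"
    "\<And>\<psi> x. \<psi> \<in> C \<Longrightarrow> \<psi> x - r \<psi> x = (1 - ?E x) * q \<psi> x"
    by metis
  define a where "a \<phi> = (\<Sum>\<psi> | \<psi> \<in> C \<and> r \<psi> = \<phi>. of_int (m \<psi>) :: complex)" for \<phi>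
  have h2: "(\<Sum>\<psi>\<in>C. of_int (m \<psi>) * r \<psi> x) = (\<Sum>\<phi>\<in>r ` C. a \<phi> * \<phi> x)" for x
  proof -
    have "(\<Sum>\<psi>\<in>C. of_int (m \<psi>) * r \<psi> x)
        = (\<Sum>\<phi>\<in>r ` C. \<Sum>\<psi> | \<psi> \<in> C \<and> r \<psi> = \<phi>. of_int (m \<psi>) * r \<psi> x)"
      by (rule sum.image_gen[OF C(1)])
    also have "\<dots> = (\<Sum>\<phi>\<in>r ` C. a \<phi> * \<phi> x)"
      unfolding a_def by (intro sum.cong refl) (auto simp: sum_distrib_right)
    finally show ?thesis .
  qed
  have a0: "a \<phi> = 0" if "\<phi> \<in> r ` C" for \<phi>
  proof (rule characters_independent[where C = "r ` C" and S = "{x. \<beta> x \<in> \<int>}" and a = a])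
    show "finite (r ` C)" using C by simp
    show "x + y \<in> {x. \<beta> x \<in> \<int>}" if "x \<in> {x. \<beta> x \<in> \<int>}" "y \<in> {x. \<beta> x \<in> \<int>}" for x y
      using that by (simp add: blinfun.add_right)
    have rC: "r ` C \<subseteq> unitary_chars L" using r C by auto
    then show "\<psi> (x + y) = \<psi> x * \<psi> y" if "\<psi> \<in> r ` C" for \<psi> x y
      using that unfolding unitary_chars_def by auto
    have "\<psi> 0 \<noteq> 0" if "\<psi> \<in> r ` C" for \<psi>
    proof -
      have "cmod (\<psi> 0) = 1" using that rC unfolding unitary_chars_def by auto
      then show ?thesis by auto
    qed
    then show "\<exists>x\<in>{x. \<beta> x \<in> \<int>}. \<psi> x \<noteq> 0" if "\<psi> \<in> r ` C" for \<psi>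
      using that by (intro bexI[of _ 0]) auto
    show "\<phi> = \<psi>" if "\<phi> \<in> r ` C" "\<psi> \<in> r ` C" "\<And>x. x \<in> {x. \<beta> x \<in> \<int>} \<Longrightarrow> \<phi> x = \<psi> x" for \<phi> \<psi>
    proof -
      \<comment> \<open>Representatives are fixed by \<open>r\<close>, hence two of them with the
        same restriction coincide.\<close>
      have r_fix: "r \<eta> = \<eta>" if "\<eta> \<in> r ` C" for \<eta>
      proof -
        from that obtain \<psi> where "\<psi> \<in> C" "\<eta> = r \<psi>" by blast
        moreover have "r (r \<psi>) = r \<psi>" using r(2)[OF \<open>\<psi> \<in> C\<close>] by (rule r_eq)
        ultimately show ?thesis by (simp only:)
      qed
      have "r \<phi> = r \<psi>" using that(3) by (intro r_eq) simp
      then show ?thesis unfolding r_fix[OF that(1)] r_fix[OF that(2)] .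
    qed
    show "(\<Sum>\<psi>\<in>r ` C. a \<psi> * \<psi> x) = 0" if "x \<in> {x. \<beta> x \<in> \<int>}" for x
    proof -
      have "(\<Sum>\<psi>\<in>C. of_int (m \<psi>) * r \<psi> x) = h x"
        unfolding h_eq using that r by (intro sum.cong) auto
      then show ?thesis using h2 vanish that by simp
    qed
    show "\<phi> \<in> r ` C" by fact
  qed
  have "h x = (1 - ?E x) * (\<Sum>\<psi>\<in>C. of_int (m \<psi>) * q \<psi> x)" for x
  proof -
    have "h x = (\<Sum>\<psi>\<in>C. of_int (m \<psi>) * (\<psi> x - r \<psi> x)) + (\<Sum>\<psi>\<in>C. of_int (m \<psi>) * r \<psi> x)"
      unfolding h_eq sum.distrib[symmetric] by (intro sum.cong) (auto simp: right_diff_distrib)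
    also have "(\<Sum>\<psi>\<in>C. of_int (m \<psi>) * r \<psi> x) = 0"
      unfolding h2 using a0 by simp
    also have "(\<Sum>\<psi>\<in>C. of_int (m \<psi>) * (\<psi> x - r \<psi> x)) = (\<Sum>\<psi>\<in>C. (1 - ?E x) * (of_int (m \<psi>) * q \<psi> x))"
      using q(2) by (intro sum.cong) auto
    finally show ?thesis by (simp add: sum_distrib_left)
  qed
  moreover have "(\<lambda>x. \<Sum>\<psi>\<in>C. of_int (m \<psi>) * q \<psi> x) \<in> ?R"
  proof (intro int_span_sum char_ring_mult q)
    show "(\<lambda>x. of_int (m \<psi>)) \<in> ?R" for \<psi>
      using int_span_scaled[OF unitary_chars_one, of "m \<psi>" L] by simp
  qed
  ultimately show ?thesis
    by (intro bexI[of _ "\<lambda>x. \<Sum>\<psi>\<in>C. of_int (m \<psi>) * q \<psi> x"] allI)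
qed

section \<open>Functions that are nonzero on a dense subset of a kernel\<close>

text \<open>Density of the nonvanishing set is expressed as cancellability against continuous
  functions on the set where \<open>\<beta>\<close> is integral. This is the form in which it is
  used, and it passes to products directly. For \<open>\<beta> = 0\<close> the set is the whole
  space.\<close>

definition generic_on :: "('v::real_normed_vector \<Rightarrow>\<^sub>L real) \<Rightarrow> ('v \<Rightarrow> complex) \<Rightarrow> bool" where
  "generic_on \<beta> X \<longleftrightarrow> (\<forall>A. continuous_on UNIV A \<longrightarrow>
     (\<forall>x. \<beta> x \<in> \<int> \<longrightarrow> A x * X x = 0) \<longrightarrow> (\<forall>x. \<beta> x \<in> \<int> \<longrightarrow> A x = 0))"

lemma generic_onD:
  "generic_on \<beta> X \<Longrightarrow> continuous_on UNIV A \<Longrightarrow> (\<And>x. \<beta> x \<in> \<int> \<Longrightarrow> A x * X x = 0) \<Longrightarrow>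
    \<beta> x \<in> \<int> \<Longrightarrow> A x = 0"
  unfolding generic_on_def by blast

lemma generic_on_one: "generic_on \<beta> (\<lambda>x. 1)"
  unfolding generic_on_def by auto

text \<open>Cancel \<open>Y\<close> first and then \<open>X\<close>. The first cancellation leaves
  \<open>A * X\<close>, which has to be continuous.\<close>

lemma generic_on_mult:
  assumes "generic_on \<beta> X" "generic_on \<beta> Y" "continuous_on UNIV X"
  shows "generic_on \<beta> (\<lambda>x. X x * Y x)"
  unfolding generic_on_def
proof (intro allI impI)
  fix A x
  assume A: "continuous_on UNIV A" "\<forall>x. \<beta> x \<in> \<int> \<longrightarrow> A x * (X x * Y x) = 0" and x: "\<beta> x \<in> \<int>"
  have "A x * X x = 0" if "\<beta> x \<in> \<int>" for x
    using generic_onD[OF assms(2), of "\<lambda>x. A x * X x"] A assms(3) that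
    by (auto intro!: continuous_intros simp: mult.assoc)
  then show "A x = 0" using generic_onD[OF assms(1) A(1)] x by blast
qed

lemma generic_on_prod:
  assumes "\<And>i. i \<in> I \<Longrightarrow> generic_on \<beta> (X i)" "\<And>i. i \<in> I \<Longrightarrow> continuous_on UNIV (X i)"
  shows "generic_on \<beta> (\<lambda>x. \<Prod>i\<in>I. X i x)"
  using assms
  by (induction I rule: infinite_finite_induct) (auto intro: generic_on_one generic_on_mult)

text \<open>Some \<open>v\<close> has \<open>\<beta> v = 0\<close> and
  \<open>\<gamma> v = 1\<close>. Moving along \<open>v\<close> does not change
  \<open>\<beta>\<close>, and from a zero of the factor it leads at once to points where the factor
  is nonzero. There \<open>A\<close> vanishes, so it vanishes at the zero as well, by
  continuity.\<close>

lemma generic_on_cis: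
  fixes \<beta> \<gamma> :: "'v::real_normed_vector \<Rightarrow>\<^sub>L real"
  assumes indep: "\<And>c. \<gamma> \<noteq> c *\<^sub>R \<beta>"
  shows "generic_on \<beta> (\<lambda>x. 1 - cis (2 * pi * \<gamma> x))"
  unfolding generic_on_def
proof (intro allI impI)
  fix A x
  assume A: "continuous_on UNIV A" and zero: "\<forall>x. \<beta> x \<in> \<int> \<longrightarrow> A x * (1 - cis (2 * pi * \<gamma> x)) = 0"
    and x: "\<beta> x \<in> \<int>"
  \<comment> \<open>A functional that vanishes on the kernel of \<open>\<beta>\<close> is a multiple
    of \<open>\<beta>\<close>; if \<open>\<beta> = 0\<close>, it is the zero multiple.\<close>
  have "\<exists>v. \<beta> v = 0 \<and> \<gamma> v \<noteq> 0"
  proof (rule ccontr)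
    assume "\<not> ?thesis"
    then have *: "\<gamma> v = 0" if "\<beta> v = 0" for v using that by blast
    show False
    proof (cases "\<beta> = 0")
      case True
      then have "\<gamma> = 0" using * by (intro blinfun_eqI) auto
      then show False using indep[of 0] by simp
    next
      case False
      then obtain y where y: "\<beta> y = 1" by (rule blinfun_nonzero_obtain)
      have "\<gamma> z = (\<gamma> y *\<^sub>R \<beta>) z" for z
      proof -
        have "\<beta> (z - \<beta> z *\<^sub>R y) = 0"
          by (simp add: blinfun.diff_right blinfun.scaleR_right y)
        then have "\<gamma> (z - \<beta> z *\<^sub>R y) = 0"
          by (rule *)
        then have "\<gamma> z = \<beta> z * \<gamma> y"
          by (simp only: blinfun.diff_right blinfun.scaleR_right real_scaleR_def right_minus_eq)
        then show ?thesis by (simp add: scaleR_blinfun.rep_eq)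
      qed
      then have "\<gamma> = \<gamma> y *\<^sub>R \<beta>" by (rule blinfun_eqI)
      then show False using indep by blast
    qed
  qed
  then obtain v0 where v0: "\<beta> v0 = 0" "\<gamma> v0 \<noteq> 0" by blast
  define v where "v = v0 /\<^sub>R \<gamma> v0"
  have v: "\<beta> v = 0" "\<gamma> v = 1" using v0 by (simp_all add: v_def blinfun.scaleR_right)
  show "A x = 0"
  proof (cases "\<gamma> x \<in> \<int>")
    case False
    then show ?thesis using zero x by (auto simp: cis_2pi_eq_1_iff)
  next
    case True
    have Az: "A (x + t *\<^sub>R v) = 0" if "0 < t" "t < 1" for t
    proof -
      have "\<gamma> (x + t *\<^sub>R v) \<notin> \<int>"
      proof
        assume "\<gamma> (x + t *\<^sub>R v) \<in> \<int>"
        then have "\<gamma> x + t \<in> \<int>" by (simp add: blinfun.add_right blinfun.scaleR_right v)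
        then have "\<gamma> x + t - \<gamma> x \<in> \<int>" using True by (rule Ints_diff)
        then have "t \<in> \<int>" by simp
        then obtain k :: int where "t = of_int k" by (rule Ints_cases)
        then show False using that by simp
      qed
      moreover have "\<beta> (x + t *\<^sub>R v) \<in> \<int>"
        using x by (simp add: blinfun.add_right blinfun.scaleR_right v)
      ultimately show ?thesis using zero by (auto simp: cis_2pi_eq_1_iff)
    qed
    have "continuous_on UNIV (\<lambda>t. A (x + t *\<^sub>R v))"
      by (intro continuous_on_compose2[OF A] continuous_intros) auto
    then have "isCont (\<lambda>t. A (x + t *\<^sub>R v)) 0"
      by (simp add: continuous_on_eq_continuous_at)
    then have "((\<lambda>t. A (x + t *\<^sub>R v)) \<longlongrightarrow> A (x + 0 *\<^sub>R v)) (at_right 0)"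
      unfolding isCont_def filterlim_at_split by blast
    moreover have "\<forall>\<^sub>F t in at_right 0. A (x + t *\<^sub>R v) = 0"
      unfolding eventually_at_right_field using Az by (intro exI[of _ 1]) auto
    ultimately have "((\<lambda>t::real. 0) \<longlongrightarrow> A (x + 0 *\<^sub>R v)) (at_right 0)"
      by (simp only: tendsto_cong)
    then show ?thesis by (simp add: tendsto_const_iff)
  qed
qed

section \<open>Cancellation of poles\<close>

text \<open>The part of the action that governs the cancellation, transported to the Lie algebra.
  The isotropy group of \<open>e\<close> becomes the set where \<open>\<alpha> e\<close> is
  integral, and the isotropy representations enter only through \<open>weights_edge\<close>.\<close>

locale weighted_graph =
  fixes L :: "'v::real_normed_vector set"
    and V :: "'p set" and A :: "'e set"
    and tl :: "'e \<Rightarrow> 'p" and rv :: "'e \<Rightarrow> 'e"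
    and \<alpha> :: "'e \<Rightarrow> 'v \<Rightarrow>\<^sub>L real"
    and F :: "'p \<Rightarrow> 'v \<Rightarrow> complex"
  assumes finite_V: "finite V" and finite_A: "finite A"
    and tl_in: "e \<in> A \<Longrightarrow> tl e \<in> V"
    and rv_in: "e \<in> A \<Longrightarrow> rv e \<in> A"
    and rv_rv: "e \<in> A \<Longrightarrow> rv (rv e) = e"
    and weight_rv: "e \<in> A \<Longrightarrow> \<alpha> (rv e) = - \<alpha> e"
    and weight_char_in: "e \<in> A \<Longrightarrow> (\<lambda>x. cis (2 * pi * \<alpha> e x)) \<in> unitary_chars L"
    and weight_nonzero: "e \<in> A \<Longrightarrow> \<alpha> e \<noteq> 0"
    and weights_indep: "\<lbrakk>e1 \<in> A; e2 \<in> A; e1 \<noteq> e2; tl e1 = tl e2\<rbrakk> \<Longrightarrow> \<alpha> e1 \<noteq> c *\<^sub>R \<alpha> e2"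
    and class_in: "p \<in> V \<Longrightarrow> F p \<in> int_span (unitary_chars L)"
    and class_edge: "e \<in> A \<Longrightarrow> \<alpha> e x \<in> \<int> \<Longrightarrow> F (tl e) x = F (tl (rv e)) x"
    and weights_edge: "e \<in> A \<Longrightarrow> \<alpha> e x \<in> \<int> \<Longrightarrow>
      (\<Prod>e' | e' \<in> A \<and> tl e' = tl e \<and> e' \<noteq> e. 1 - cis (2 * pi * \<alpha> e' x)) =
      (\<Prod>e' | e' \<in> A \<and> tl e' = tl (rv e) \<and> e' \<noteq> rv e. 1 - cis (2 * pi * \<alpha> e' x))"
begin

abbreviation char_ring :: "('v \<Rightarrow> complex) set" where
  "char_ring \<equiv> int_span (unitary_chars L)"

definition euler :: "'e \<Rightarrow> 'v \<Rightarrow> complex" where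
  "euler e x = 1 - cis (2 * pi * \<alpha> e x)"

definition out :: "'p \<Rightarrow> 'e set" where
  "out p = {e \<in> A. tl e = p}"

lemma out_subset: "out p \<subseteq> A"
  by (auto simp: out_def)

lemma finite_out: "finite (out p)"
  using finite_subset[OF out_subset finite_A] .

lemma euler_in: "e \<in> A \<Longrightarrow> euler e \<in> char_ring"
  unfolding euler_def[abs_def]
  by (intro int_span_diff char_ring_one int_span_base weight_char_in)

lemma euler_prod_in: "I \<subseteq> A \<Longrightarrow> (\<lambda>x. \<Prod>e\<in>I. euler e x) \<in> char_ring"
  by (intro char_ring_prod euler_in) auto

lemma euler_eq_0_iff: "euler e x = 0 \<longleftrightarrow> \<alpha> e x \<in> \<int>"
  unfolding euler_def by (simp flip: cis_2pi_eq_1_iff)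

lemma euler_prod_generic:
  assumes "I \<subseteq> A" "\<And>e c. e \<in> I \<Longrightarrow> \<alpha> e \<noteq> c *\<^sub>R \<beta>"
  shows "generic_on \<beta> (\<lambda>x. \<Prod>e\<in>I. euler e x)"
proof (rule generic_on_prod)
  show "generic_on \<beta> (euler e)" if "e \<in> I" for e
    unfolding euler_def[abs_def] by (rule generic_on_cis) (rule assms(2)[OF that])
  show "continuous_on UNIV (euler e)" if "e \<in> I" for e
    using char_ring_continuous[OF euler_in] that assms(1) by blast
qed

definition regular :: "'v \<Rightarrow> bool" where
  "regular x \<longleftrightarrow> (\<forall>e\<in>A. euler e x \<noteq> 0)"

lemma euler_prod_nonzero: "regular x \<Longrightarrow> I \<subseteq> A \<Longrightarrow> (\<Prod>e\<in>I. euler e x) \<noteq> 0"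
  using finite_subset[OF _ finite_A] unfolding regular_def by (subst prod_zero_iff) auto

text \<open>Regular points are dense: the product of all factors is generic for the zero functional,
  because no weight is zero. Identities between fractions can therefore be checked at regular
  points, where no denominator vanishes.\<close>

lemma eq_if_eq_on_regular:
  assumes "a \<in> char_ring" "b \<in> char_ring" and eq: "\<And>x. regular x \<Longrightarrow> a x = b x"
  shows "a x = b x"
proof -
  have "generic_on 0 (\<lambda>x. \<Prod>e\<in>A. euler e x)"
    by (rule euler_prod_generic) (use weight_nonzero in auto)
  then have "a x - b x = 0"
  proof (rule generic_onD)
    show "continuous_on UNIV (\<lambda>x. a x - b x)"
      using assms char_ring_continuous by (intro continuous_intros) auto
    show "(a y - b y) * (\<Prod>e\<in>A. euler e y) = 0" for y
      using eq[of y] finite_A by (auto simp: regular_def)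
  qed simp
  then show ?thesis by simp
qed

section \<open>Sums of local terms without a pole along the line of a weight\<close>

text \<open>
  Membership in the localisation of the character ring at the elements that are not zero divisors
  on the kernel of \<open>e\<^sup>2\<^sup>\<pi>\<^sup>i\<^sup>\<beta>\<close>; only the values on the regular set matter.
\<close>

definition no_pole :: "('v \<Rightarrow>\<^sub>L real) \<Rightarrow> ('v \<Rightarrow> complex) \<Rightarrow> bool" where
  "no_pole \<beta> \<phi> \<longleftrightarrow> (\<exists>X\<in>char_ring. \<exists>b\<in>char_ring. generic_on \<beta> X \<and>
     (\<forall>x. regular x \<longrightarrow> \<phi> x * X x = b x))"

lemma no_poleI:
  "X \<in> char_ring \<Longrightarrow> b \<in> char_ring \<Longrightarrow> generic_on \<beta> X \<Longrightarrow>
    (\<And>x. regular x \<Longrightarrow> \<phi> x * X x = b x) \<Longrightarrow> no_pole \<beta> \<phi>"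
  unfolding no_pole_def by blast

lemma no_pole_zero: "no_pole \<beta> (\<lambda>x. 0)"
  by (rule no_poleI[OF char_ring_one int_span_zero generic_on_one]) simp

lemma no_pole_add:
  assumes "no_pole \<beta> \<phi>" "no_pole \<beta> \<psi>"
  shows "no_pole \<beta> (\<lambda>x. \<phi> x + \<psi> x)"
proof -
  obtain X a where X: "X \<in> char_ring" "a \<in> char_ring" "generic_on \<beta> X"
    "\<And>x. regular x \<Longrightarrow> \<phi> x * X x = a x"
    using assms(1) unfolding no_pole_def by blast
  obtain Y b where Y: "Y \<in> char_ring" "b \<in> char_ring" "generic_on \<beta> Y"
    "\<And>x. regular x \<Longrightarrow> \<psi> x * Y x = b x"
    using assms(2) unfolding no_pole_def by blast
  show ?thesis
  proof (rule no_poleI)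
    show "(\<lambda>x. X x * Y x) \<in> char_ring" by (rule char_ring_mult[OF X(1) Y(1)])
    show "(\<lambda>x. a x * Y x + b x * X x) \<in> char_ring"
      by (rule int_span_add[OF char_ring_mult[OF X(2) Y(1)] char_ring_mult[OF Y(2) X(1)]])
    show "generic_on \<beta> (\<lambda>x. X x * Y x)"
      by (intro generic_on_mult char_ring_continuous[OF X(1)] X(3) Y(3))
    show "(\<phi> x + \<psi> x) * (X x * Y x) = a x * Y x + b x * X x" if "regular x" for x
      unfolding X(4)[OF that, symmetric] Y(4)[OF that, symmetric] by (simp add: algebra_simps)
  qed
qed

lemma no_pole_sum:
  "(\<And>i. i \<in> I \<Longrightarrow> no_pole \<beta> (\<phi> i)) \<Longrightarrow> no_pole \<beta> (\<lambda>x. \<Sum>i\<in>I. \<phi> i x)"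
  by (induction I rule: infinite_finite_induct) (auto intro: no_pole_zero no_pole_add)

definition local_term :: "'p \<Rightarrow> 'v \<Rightarrow> complex" where
  "local_term p x = F p x / (\<Prod>e\<in>out p. euler e x)"

lemma local_term_no_pole:
  assumes "p \<in> V" "\<And>e c. e \<in> out p \<Longrightarrow> \<alpha> e \<noteq> c *\<^sub>R \<beta>"
  shows "no_pole \<beta> (local_term p)"
proof (rule no_poleI)
  show "(\<lambda>x. \<Prod>e\<in>out p. euler e x) \<in> char_ring"
    by (rule euler_prod_in[OF out_subset])
  show "F p \<in> char_ring" using assms class_in by auto
  show "generic_on \<beta> (\<lambda>x. \<Prod>e\<in>out p. euler e x)"
    by (rule euler_prod_generic) (use assms in \<open>auto simp: out_def\<close>)
  show "local_term p x * (\<Prod>e\<in>out p. euler e x) = F p x" if "regular x" for x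
    using euler_prod_nonzero[OF that out_subset] by (simp add: local_term_def)
qed

text \<open>Write E for e^{2 pi i \<alpha>}, \<alpha> the weight of \<open>e\<close>. Since 1 / (1 -
  1/E) = - E / (1 - E), the two terms have the common denominator 1 - E up to the factors of the
  other edges. The resulting numerator \<open>h\<close> vanishes where the weight is integral: there
  E = 1, and the congruences identify the class and the remaining factors at both ends. So
  \<open>char_ring_divisible\<close> cancels 1 - E.\<close>

lemma edge_terms_no_pole:
  assumes e: "e \<in> A" and t: "\<alpha> e = t *\<^sub>R \<beta>" "t \<noteq> 0"
  shows "no_pole \<beta> (\<lambda>x. local_term (tl e) x + local_term (tl (rv e)) x)"
proof -
  \<comment> \<open>At either end, independence from the weight of the edge itself is independence
    from \<open>\<beta>\<close>, as the two are proportional.\<close>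
  have rest_generic: "\<alpha> e'' \<noteq> c *\<^sub>R \<beta>"
    if "e' \<in> {e, rv e}" "e'' \<in> out (tl e') - {e'}" for e' e'' c
  proof -
    obtain s where s: "\<beta> = s *\<^sub>R \<alpha> e'"
    proof (cases "e' = e")
      case True
      then show ?thesis using that[of "1 / t"] t by simp
    next
      case False
      then have "e' = rv e" using \<open>e' \<in> {e, rv e}\<close> by simp
      then show ?thesis using that[of "- (1 / t)"] t e by (simp add: weight_rv)
    qed
    have "\<alpha> e'' \<noteq> (c * s) *\<^sub>R \<alpha> e'"
      using that e rv_in by (intro weights_indep) (auto simp: out_def)
    then show ?thesis by (simp add: s)
  qed
  let ?Q = "\<lambda>e' x. \<Prod>e''\<in>out (tl e') - {e'}. euler e'' x"
  let ?E = "\<lambda>x. cis (2 * pi * \<alpha> e x)"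
  have Q_in: "?Q e' \<in> char_ring" for e'
    by (rule euler_prod_in) (auto simp: out_def)
  have Q_generic: "generic_on \<beta> (?Q e')" if "e' \<in> {e, rv e}" for e'
    by (rule euler_prod_generic) (use rest_generic[OF that] in \<open>auto simp: out_def\<close>)
  define h where "h x = F (tl e) x * ?Q (rv e) x - ?E x * F (tl (rv e)) x * ?Q e x" for x
  have "h \<in> char_ring"
    unfolding h_def[abs_def]
    by (intro int_span_diff char_ring_mult Q_in class_in tl_in rv_in int_span_base weight_char_in e)
  moreover have "h x = 0" if "\<alpha> e x \<in> \<int>" for x
  proof -
    have "?Q e x = ?Q (rv e) x"
      using weights_edge[OF e that] unfolding euler_def out_def
      by (simp add: set_diff_eq conj_assoc)
    moreover have "?E x = 1" using that by (simp add: cis_2pi_eq_1_iff)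
    ultimately show ?thesis using class_edge[OF e that] by (simp add: h_def)
  qed
  ultimately obtain b where b: "b \<in> char_ring" "\<And>x. h x = euler e x * b x"
    using char_ring_divisible weight_char_in[OF e] weight_nonzero[OF e]
    unfolding euler_def by blast
  show ?thesis
  proof (rule no_poleI)
    show "(\<lambda>x. ?Q e x * ?Q (rv e) x) \<in> char_ring" by (intro char_ring_mult Q_in)
    show "generic_on \<beta> (\<lambda>x. ?Q e x * ?Q (rv e) x)"
      by (intro generic_on_mult Q_generic char_ring_continuous[OF Q_in]) auto
    show "(local_term (tl e) x + local_term (tl (rv e)) x) * (?Q e x * ?Q (rv e) x) = b x"
      if reg: "regular x" for x
    proof -
      have out_prod: "(\<Prod>e''\<in>out (tl e'). euler e'' x) = euler e' x * ?Q e' x" if "e' \<in> A" for e'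
        by (rule prod.remove[OF finite_out]) (use that in \<open>simp add: out_def\<close>)
      have Q_nz: "?Q e' x \<noteq> 0" for e'
        using out_subset by (intro euler_prod_nonzero[OF reg]) blast
      have c_nz: "euler e x \<noteq> 0" "euler (rv e) x \<noteq> 0"
        using reg e rv_in by (auto simp: regular_def)
      \<comment> \<open>Reversal inverts the character, which turns the factor of the reversed edge
        into that of \<open>e\<close> up to a unit.\<close>
      have "?E x * cis (2 * pi * \<alpha> (rv e) x) = 1"
        by (simp add: weight_rv[OF e] cis_mult blinfun.minus_left)
      then have "?E x * euler (rv e) x = - euler e x"
        by (simp add: euler_def right_diff_distrib)
      then have inv: "1 / euler (rv e) x = - ?E x / euler e x"
        using c_nz by (simp add: field_simps)
      have "local_term (tl e) x * (?Q e x * ?Q (rv e) x) = F (tl e) x * ?Q (rv e) x / euler e x"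
        unfolding local_term_def out_prod[OF e] using Q_nz c_nz by simp
      moreover have "local_term (tl (rv e)) x * (?Q e x * ?Q (rv e) x)
          = F (tl (rv e)) x * ?Q e x * (1 / euler (rv e) x)"
        unfolding local_term_def out_prod[OF rv_in[OF e]] using Q_nz c_nz by simp
      ultimately have "(local_term (tl e) x + local_term (tl (rv e)) x) * (?Q e x * ?Q (rv e) x)
          = h x / euler e x"
        unfolding inv h_def distrib_right by (simp add: diff_divide_distrib mult_ac)
      then show ?thesis using b(2) c_nz by simp
    qed
  qed (rule b(1))
qed

text \<open>A vertex without an outgoing edge on the line of \<open>\<alpha> e0\<close> has a
  generic denominator. The remaining vertices are the ends of edges on that line, each belonging to
  exactly one such edge, and are grouped into the pairs treated by
  \<open>edge_terms_no_pole\<close>.\<close>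

lemma sum_local_terms_no_pole:
  assumes e0: "e0 \<in> A"
  shows "no_pole (\<alpha> e0) (\<lambda>x. \<Sum>p\<in>V. local_term p x)"
proof -
  \<comment> \<open>The sign of the multiple selects one orientation of each edge on the
    line.\<close>
  define P where "P = {e \<in> A. \<exists>t>0. \<alpha> e = t *\<^sub>R \<alpha> e0}"
  define A0 where "A0 = P \<union> rv ` P"
  have A0: "e \<in> A0 \<longleftrightarrow> e \<in> A \<and> (\<exists>t. \<alpha> e = t *\<^sub>R \<alpha> e0)" for e
  proof
    assume "e \<in> A0"
    then show "e \<in> A \<and> (\<exists>t. \<alpha> e = t *\<^sub>R \<alpha> e0)"
    proof (unfold A0_def, elim UnE imageE)
      fix e' assume "e = rv e'" "e' \<in> P"
      then obtain t where "e' \<in> A" "\<alpha> e' = t *\<^sub>R \<alpha> e0" "e = rv e'" unfolding P_def by blast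
      then have "e \<in> A" "\<alpha> e = (- t) *\<^sub>R \<alpha> e0" by (simp_all add: rv_in weight_rv)
      then show ?thesis by blast
    qed (auto simp: P_def)
  next
    assume "e \<in> A \<and> (\<exists>t. \<alpha> e = t *\<^sub>R \<alpha> e0)"
    then obtain t where t: "e \<in> A" "\<alpha> e = t *\<^sub>R \<alpha> e0" by blast
    then have "t \<noteq> 0" using weight_nonzero by auto
    then consider "t > 0" | "t < 0" by linarith
    then show "e \<in> A0"
    proof cases
      case 1
      then show ?thesis using t by (auto simp: A0_def P_def)
    next
      case 2
      then have "\<alpha> (rv e) = (- t) *\<^sub>R \<alpha> e0" using t by (simp add: weight_rv)
      then have "rv e \<in> P" unfolding P_def using 2 t rv_in by (auto intro!: exI[of _ "- t"])
      then show ?thesis using rv_rv[OF t(1)] by (force simp: A0_def)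
    qed
  qed
  have disj: "P \<inter> rv ` P = {}"
  proof -
    have False if "e \<in> P" "rv e \<in> P" for e
    proof -
      from that obtain s t
        where "s > 0" "t > 0" "\<alpha> e = s *\<^sub>R \<alpha> e0" "\<alpha> (rv e) = t *\<^sub>R \<alpha> e0" "e \<in> A"
        unfolding P_def by blast
      then have "(s + t) *\<^sub>R \<alpha> e0 = \<alpha> e + \<alpha> (rv e)" by (simp only: scaleR_add_left)
      also have "\<dots> = 0" using weight_rv[OF \<open>e \<in> A\<close>] by simp
      finally show False using \<open>s > 0\<close> \<open>t > 0\<close> weight_nonzero[OF e0] by simp
    qed
    then show ?thesis by auto
  qed
  have fin: "finite P" "finite A0" using finite_A by (simp_all add: P_def A0_def)
  have inj_rv: "inj_on rv P" by (rule inj_on_inverseI[of _ rv]) (auto simp: P_def rv_rv)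
  \<comment> \<open>Two edges on the line leaving the same vertex would have dependent
    weights.\<close>
  have inj_tl: "inj_on tl A0"
  proof (rule inj_onI, rule ccontr)
    fix e1 e2 assume *: "e1 \<in> A0" "e2 \<in> A0" "tl e1 = tl e2" "e1 \<noteq> e2"
    then obtain s t where st: "\<alpha> e1 = s *\<^sub>R \<alpha> e0" "\<alpha> e2 = t *\<^sub>R \<alpha> e0" "e1 \<in> A" "e2 \<in> A"
      unfolding A0 by blast
    then have "t \<noteq> 0" using weight_nonzero by auto
    then have "\<alpha> e1 = (s / t) *\<^sub>R \<alpha> e2" using st by simp
    then show False using weights_indep[of e1 e2] * st by blast
  qed
  have "(\<Sum>p\<in>V. local_term p x) = (\<Sum>p\<in>V - tl ` A0. local_term p x) +
      (\<Sum>e\<in>P. local_term (tl e) x + local_term (tl (rv e)) x)" for x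
  proof -
    have "(\<Sum>p\<in>V. local_term p x) = (\<Sum>p\<in>V - tl ` A0. local_term p x) + (\<Sum>p\<in>tl ` A0. local_term p x)"
      using finite_V tl_in A0 by (intro sum.subset_diff) auto
    also have "(\<Sum>p\<in>tl ` A0. local_term p x) = (\<Sum>e\<in>A0. local_term (tl e) x)"
      using inj_tl by (simp add: sum.reindex)
    also have "\<dots> = (\<Sum>e\<in>P. local_term (tl e) x) + (\<Sum>e\<in>rv ` P. local_term (tl e) x)"
      unfolding A0_def using fin disj by (intro sum.union_disjoint) auto
    also have "(\<Sum>e\<in>rv ` P. local_term (tl e) x) = (\<Sum>e\<in>P. local_term (tl (rv e)) x)"
      using inj_rv by (simp add: sum.reindex)
    finally show ?thesis by (simp add: sum.distrib)
  qed
  moreover have "no_pole (\<alpha> e0) (\<lambda>x. (\<Sum>p\<in>V - tl ` A0. local_term p x) +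
      (\<Sum>e\<in>P. local_term (tl e) x + local_term (tl (rv e)) x))"
  proof (rule no_pole_add; rule no_pole_sum)
    show "no_pole (\<alpha> e0) (local_term p)" if "p \<in> V - tl ` A0" for p
      by (rule local_term_no_pole) (use that in \<open>auto simp: A0 out_def image_iff\<close>)
    show "no_pole (\<alpha> e0) (\<lambda>x. local_term (tl e) x + local_term (tl (rv e)) x)" if "e \<in> P" for e
      using that edge_terms_no_pole unfolding P_def by blast
  qed
  ultimately show ?thesis by simp
qed

text \<open>
  The factors are split off one at a time: what is left vanishes on the kernel of the next weight,
  since the sum of the local terms has no pole there.
\<close>

theorem numerator_divisible:
  "\<exists>b\<in>char_ring. \<forall>x. (\<Sum>p\<in>V. F p x * (\<Prod>e\<in>A - out p. euler e x)) = (\<Prod>e\<in>A. euler e x) * b x"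
proof -
  define N where "N x = (\<Sum>p\<in>V. F p x * (\<Prod>e\<in>A - out p. euler e x))" for x
  have N_in: "N \<in> char_ring"
    unfolding N_def[abs_def]
    by (intro int_span_sum char_ring_mult class_in euler_prod_in) auto
  have N_eq: "N x = (\<Prod>e\<in>A. euler e x) * (\<Sum>p\<in>V. local_term p x)" if "regular x" for x
  proof -
    have "F p x * (\<Prod>e\<in>A - out p. euler e x) = (\<Prod>e\<in>A. euler e x) * local_term p x" for p
    proof -
      have "(\<Prod>e\<in>A. euler e x) = (\<Prod>e\<in>A - out p. euler e x) * (\<Prod>e\<in>out p. euler e x)"
        using finite_A by (intro prod.subset_diff) (auto simp: out_def)
      moreover have "(\<Prod>e\<in>out p. euler e x) \<noteq> 0"
        by (rule euler_prod_nonzero[OF that out_subset])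
      ultimately show ?thesis by (simp add: local_term_def)
    qed
    then show ?thesis by (simp add: N_def sum_distrib_left)
  qed
  \<comment> \<open>\<open>I\<close> holds the factors already split off; the theorem is the case
    \<open>I = A\<close>.\<close>
  have "\<exists>b\<in>char_ring. \<forall>x. N x = (\<Prod>e\<in>I. euler e x) * b x" if "I \<subseteq> A" for I
    using finite_subset[OF that finite_A] that
  proof (induction I rule: finite_induct)
    case empty
    then show ?case using N_in by auto
  next
    case (insert e0 I)
    then have e0: "e0 \<in> A" "e0 \<notin> I" and I: "I \<subseteq> A" by auto
    obtain a where a: "a \<in> char_ring" "\<And>x. N x = (\<Prod>e\<in>I. euler e x) * a x"
      using insert by blast
    obtain X b where X: "X \<in> char_ring" "b \<in> char_ring" "generic_on (\<alpha> e0) X"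
      "\<And>x. regular x \<Longrightarrow> (\<Sum>p\<in>V. local_term p x) * X x = b x"
      using sum_local_terms_no_pole[OF e0(1)] unfolding no_pole_def by blast
    \<comment> \<open>At regular points the factors in \<open>I\<close> cancel and give
      \<open>a * X = ?r\<close>, hence everywhere by density. Since \<open>?r\<close> contains the
      factor of \<open>e0\<close>, the product \<open>a * X\<close> vanishes where
      \<open>\<alpha> e0\<close> is integral; genericity of \<open>X\<close> passes this on to
      \<open>a\<close>, which is then divisible by that factor.\<close>
    let ?r = "\<lambda>x. euler e0 x * (\<Prod>e\<in>A - insert e0 I. euler e x) * b x"
    have "a x * X x = ?r x" for x
    proof (rule eq_if_eq_on_regular)
      show "(\<lambda>x. a x * X x) \<in> char_ring" by (intro char_ring_mult a X)
      show "?r \<in> char_ring" by (intro char_ring_mult euler_in euler_prod_in e0 X) auto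
      fix x assume x: "regular x"
      have "(\<Prod>e\<in>A. euler e x) = (\<Prod>e\<in>A - insert e0 I. euler e x) * (\<Prod>e\<in>insert e0 I. euler e x)"
        using finite_A insert.prems by (intro prod.subset_diff)
      then have D: "(\<Prod>e\<in>A. euler e x) =
          (\<Prod>e\<in>I. euler e x) * (euler e0 x * (\<Prod>e\<in>A - insert e0 I. euler e x))"
        using insert.hyps by simp
      have "(\<Prod>e\<in>I. euler e x) * (a x * X x) = N x * X x"
        by (simp add: a(2))
      also have "\<dots> = (\<Prod>e\<in>A. euler e x) * b x"
        unfolding N_eq[OF x] X(4)[OF x, symmetric] by simp
      also have "\<dots> = (\<Prod>e\<in>I. euler e x) * ?r x"
        unfolding D by (simp only: mult.assoc)
      finally show "a x * X x = ?r x"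
        using euler_prod_nonzero[OF x I] by (simp only: mult_cancel_left simp_thms)
    qed
    then have "a x * X x = 0" if "\<alpha> e0 x \<in> \<int>" for x
      using that by (simp add: euler_eq_0_iff[symmetric])
    then have "a x = 0" if "\<alpha> e0 x \<in> \<int>" for x
      using generic_onD[OF X(3) char_ring_continuous[OF a(1)]] that by blast
    then obtain q where q: "q \<in> char_ring" "\<And>x. a x = euler e0 x * q x"
      using char_ring_divisible[OF a(1) weight_char_in[OF e0(1)] weight_nonzero[OF e0(1)]]
      unfolding euler_def by blast
    have "N x = (\<Prod>e\<in>insert e0 I. euler e x) * q x" for x
      using insert.hyps by (simp add: a(2) q(2))
    then show ?case using q(1) by blast
  qed
  then show ?thesis unfolding N_def by blast
qed

end

section \<open>Torus actions on graphs\<close>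

lemma char_poly_1x1:
  assumes "M \<in> carrier_mat 1 1"
  shows "char_poly M = [:- (M $$ (0, 0)), 1:]"
  using assms by (subst char_poly_upper_triangular[OF assms]) (auto simp: diag_mat_def)

text \<open>Block by block, by multiplicativity on block diagonal matrices. The dimension is carried
  through the induction because the block formula requires it.\<close>

lemma char_poly_direct_sum_rep:
  assumes "\<And>\<rho>. \<rho> \<in> set \<rho>s \<Longrightarrow> \<rho> g \<in> carrier_mat 1 1"
  shows "direct_sum_rep \<rho>s g \<in> carrier_mat (length \<rho>s) (length \<rho>s) \<and>
    char_poly (direct_sum_rep \<rho>s g) = (\<Prod>\<rho>\<leftarrow>\<rho>s. [:- (\<rho> g $$ (0, 0)), 1:])"
  using assms
proof (induction \<rho>s)
  case Nil
  have "char_poly (0\<^sub>m 0 0 :: complex mat) = 1"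
    by (subst char_poly_upper_triangular[of _ 0]) (auto simp: diag_mat_def)
  then show ?case by (simp add: direct_sum_rep_def)
next
  case (Cons \<rho> \<rho>s)
  let ?n = "length \<rho>s" and ?B = "direct_sum_rep \<rho>s g"
  have B: "?B \<in> carrier_mat ?n ?n"
    "char_poly ?B = (\<Prod>\<rho>\<leftarrow>\<rho>s. [:- (\<rho> g $$ (0, 0)), 1:])"
    using Cons by auto
  have \<rho>: "\<rho> g \<in> carrier_mat 1 1" using Cons by auto
  have eq: "direct_sum_rep (\<rho> # \<rho>s) g = four_block_mat (\<rho> g) (0\<^sub>m 1 ?n) (0\<^sub>m ?n 1) ?B"
    using \<rho> B(1) by (auto simp: direct_sum_rep_def Let_def)
  then have "char_poly (direct_sum_rep (\<rho> # \<rho>s) g) = char_poly (\<rho> g) * char_poly ?B"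
    using char_poly_four_block_zeros_col[OF \<rho> _ B(1)] by simp
  moreover have "direct_sum_rep (\<rho> # \<rho>s) g \<in> carrier_mat (1 + ?n) (1 + ?n)"
    unfolding eq by (rule four_block_carrier_mat[OF \<rho> B(1)])
  ultimately show ?case using B(2) char_poly_1x1[OF \<rho>] by simp
qed

text \<open>An intertwiner makes the matrices similar at each element of \<open>S\<close>. Only this
  pointwise consequence of an isomorphism is used afterwards.\<close>

lemma rep_iso_on_char_poly:
  assumes "rep_iso_on S d \<rho> \<sigma>" "g \<in> S" "\<rho> g \<in> carrier_mat d d" "\<sigma> g \<in> carrier_mat d d"
  shows "char_poly (\<rho> g) = char_poly (\<sigma> g)"
proof -
  obtain P where P: "P \<in> Units (ring_mat TYPE(complex) d ())" "P * \<rho> g = \<sigma> g * P"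
    using assms(1,2) unfolding rep_iso_on_def by blast
  then obtain Q where Q: "P \<in> carrier_mat d d" "Q \<in> carrier_mat d d" "Q * P = 1\<^sub>m d" "P * Q = 1\<^sub>m d"
    unfolding Units_def ring_mat_simps by blast
  have "Q * \<sigma> g * P = Q * (P * \<rho> g)"
    unfolding P(2) by (rule assoc_mult_mat[OF Q(2) assms(4) Q(1)])
  also have "\<dots> = Q * P * \<rho> g"
    by (rule assoc_mult_mat[OF Q(2) Q(1) assms(3), symmetric])
  also have "\<dots> = \<rho> g" using Q(3) assms(3) by simp
  finally have "similar_mat (\<rho> g) (\<sigma> g)"
    using Q assms(3,4) by (intro similar_matI[of _ _ Q P d]) auto
  then show ?thesis by (rule char_poly_similar)
qed

lemma representation_carrier:
  assumes "representation G T d \<rho>" "g \<in> carrier G"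
  shows "\<rho> g \<in> carrier_mat d d"
proof -
  have "\<rho> g \<in> carrier (units_of (ring_mat TYPE(complex) d ()))"
    using assms unfolding representation_def hom_def by auto
  then show ?thesis by (simp add: units_of_def Units_def ring_mat_simps)
qed

section \<open>The representation ring pulled back along the exponential map\<close>

context torus
begin

abbreviation lattice :: "'v set" where "lattice \<equiv> integral_lattice G ex"

abbreviation lie_ring :: "('v \<Rightarrow> complex) set" where
  "lie_ring \<equiv> int_span (unitary_chars lattice)"

lemma ex_closed [simp]: "ex x \<in> carrier G"
  using ex_range by blast

lemma ex_cases:
  assumes "g \<in> carrier G"
  obtains x where "g = ex x"
  using assms ex_range by blast

lemma ex_0: "ex 0 = \<one>"
  using ex_add[of 0 0] by (metis add.right_neutral ex_closed r_cancel_one')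

lemma ex_minus: "ex (- x) = inv (ex x)"
proof -
  have "ex (- x) \<otimes> ex x = \<one>" using ex_0 by (simp flip: ex_add)
  then show ?thesis using inv_equality by force
qed

lemma ex_eq_iff: "ex x = ex y \<longleftrightarrow> x - y \<in> lattice"
proof -
  have "ex x = ex (x - y) \<otimes> ex y" by (simp flip: ex_add)
  then show ?thesis
    unfolding integral_lattice_def by (simp add: r_cancel_one)
qed

lemma ext_ex:
  assumes "a \<in> extensional (carrier G)" "b \<in> extensional (carrier G)" "\<And>x. a (ex x) = b (ex x)"
  shows "a = b"
  using assms(1,2) by (rule extensionalityI) (metis assms(3) ex_cases)

lemma character_comp_ex:
  assumes "\<psi> \<in> characters G T"
  shows "(\<lambda>x. \<psi> (ex x)) \<in> unitary_chars lattice"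
proof -
  have hom: "\<psi> \<in> hom G circle_group" and cont: "continuous_map T (top_of_set (sphere 0 1)) \<psi>"
    using assms unfolding characters_def by auto
  have mult: "\<psi> (g \<otimes> h) = \<psi> g * \<psi> h" if "g \<in> carrier G" "h \<in> carrier G" for g h
    using hom_mult[OF hom that] by (simp add: circle_group_def)
  have norm: "cmod (\<psi> g) = 1" if "g \<in> carrier G" for g
    using hom_in_carrier[OF hom that] by (simp add: circle_group_def)
  have "continuous_map euclidean (top_of_set (sphere 0 1)) (\<psi> \<circ> ex)"
    by (rule continuous_map_compose[OF quotient_imp_continuous_map[OF ex_quotient] cont])
  then have "continuous_on UNIV (\<psi> \<circ> ex)"
    by (simp add: continuous_map_in_subtopology)
  moreover have "\<psi> \<one> = 1"
  proof -
    have "\<psi> \<one> * \<psi> \<one> = \<psi> \<one>" using mult[of \<one> \<one>] by simp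
    moreover have "\<psi> \<one> \<noteq> 0" using norm[of \<one>] by auto
    ultimately show ?thesis by simp
  qed
  ultimately show ?thesis
    unfolding unitary_chars_def integral_lattice_def
    by (auto simp: o_def ex_add mult norm)
qed

text \<open>Preimages under \<open>ex\<close> differ by lattice vectors, on which
  \<open>\<theta>\<close> is 1, so the choice made by \<open>inv_into\<close> does not affect the
  value. Continuity holds because \<open>ex\<close> is a quotient map.\<close>

lemma unitary_char_descends:
  assumes \<theta>: "\<theta> \<in> unitary_chars lattice"
  shows "\<exists>\<psi>\<in>characters G T. \<forall>x. \<psi> (ex x) = \<theta> x"
proof -
  have cont: "continuous_on UNIV \<theta>" and mult: "\<And>x y. \<theta> (x + y) = \<theta> x * \<theta> y"
    and norm: "\<And>x. cmod (\<theta> x) = 1" and triv: "\<And>x. x \<in> lattice \<Longrightarrow> \<theta> x = 1"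
    using \<theta> unfolding unitary_chars_def by auto
  define \<psi> where "\<psi> = (\<lambda>g\<in>carrier G. \<theta> (inv_into UNIV ex g))"
  have \<psi>_ex: "\<psi> (ex x) = \<theta> x" for x
  proof -
    let ?y = "inv_into UNIV ex (ex x)"
    have "ex ?y = ex x" by (rule f_inv_into_f) auto
    then have "\<theta> (?y - x) = 1" using triv ex_eq_iff by blast
    then have "\<theta> ?y = \<theta> x" using mult[of "?y - x" x] by simp
    then show ?thesis by (simp add: \<psi>_def)
  qed
  have "\<psi> \<in> hom G circle_group"
  proof (rule homI)
    fix g h assume "g \<in> carrier G" "h \<in> carrier G"
    then obtain x y where xy: "g = ex x" "h = ex y" by (metis ex_cases)
    then show "\<psi> g \<in> carrier circle_group" by (simp add: circle_group_def \<psi>_ex norm)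
    have "\<psi> (g \<otimes> h) = \<psi> (ex (x + y))" by (simp add: xy ex_add)
    then show "\<psi> (g \<otimes> h) = \<psi> g \<otimes>\<^bsub>circle_group\<^esub> \<psi> h"
      unfolding \<psi>_ex by (simp add: xy circle_group_def \<psi>_ex mult)
  qed
  moreover have "continuous_map T (top_of_set (sphere 0 1)) \<psi>"
  proof (rule continuous_compose_quotient_map[OF ex_quotient])
    have "\<psi> \<circ> ex = \<theta>" by (auto simp: \<psi>_ex)
    then show "continuous_map euclidean (top_of_set (sphere 0 1)) (\<psi> \<circ> ex)"
      using cont norm by (auto simp: continuous_map_in_subtopology)
  qed
  moreover have "\<psi> \<in> extensional (carrier G)" by (simp add: \<psi>_def)
  ultimately show ?thesis using \<psi>_ex unfolding characters_def by blast
qed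

text \<open>Pullback turns characters into unitary characters. Conversely, each \<theta> in a
  combination descends to some \<open>k \<theta>\<close>; since pulling \<open>k \<theta>\<close>
  back returns \<theta>, the map \<open>k\<close> is injective and the coefficients carry
  over.\<close>

lemma rep_ring_iff:
  "h \<in> carrier (rep_ring G T) \<longleftrightarrow> h \<in> extensional (carrier G) \<and> (\<lambda>x. h (ex x)) \<in> lie_ring"
proof
  assume "h \<in> carrier (rep_ring G T)"
  then obtain C and m :: "('g \<Rightarrow> complex) \<Rightarrow> int" where C: "finite C" "C \<subseteq> characters G T"
    and h: "h = (\<lambda>g\<in>carrier G. \<Sum>\<psi>\<in>C. of_int (m \<psi>) * \<psi> g)"
    unfolding rep_ring_def by auto
  have "(\<lambda>x. \<Sum>\<psi>\<in>C. of_int (m \<psi>) * \<psi> (ex x)) \<in> lie_ring"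
    using C by (intro int_span_sum int_span_scaled character_comp_ex) auto
  then show "h \<in> extensional (carrier G) \<and> (\<lambda>x. h (ex x)) \<in> lie_ring"
    by (simp add: h)
next
  assume h: "h \<in> extensional (carrier G) \<and> (\<lambda>x. h (ex x)) \<in> lie_ring"
  then obtain D and m :: "('v \<Rightarrow> complex) \<Rightarrow> int" where D: "finite D" "D \<subseteq> unitary_chars lattice"
    and h_eq: "(\<lambda>x. h (ex x)) = (\<lambda>x. \<Sum>\<theta>\<in>D. of_int (m \<theta>) * \<theta> x)"
    by (auto elim: int_spanE)
  obtain k where k: "\<And>\<theta>. \<theta> \<in> D \<Longrightarrow> k \<theta> \<in> characters G T"
    "\<And>\<theta> x. \<theta> \<in> D \<Longrightarrow> k \<theta> (ex x) = \<theta> x"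
    using unitary_char_descends D(2) by (metis subsetD)
  have inj: "inj_on k D"
  proof (rule inj_onI)
    fix \<theta> \<phi> assume "\<theta> \<in> D" "\<phi> \<in> D" "k \<theta> = k \<phi>"
    then have "\<theta> x = \<phi> x" for x using k(2)[of \<theta> x] k(2)[of \<phi> x] by simp
    then show "\<theta> = \<phi>" by blast
  qed
  have comp: "(\<lambda>x. k \<theta> (ex x)) = \<theta>" if "\<theta> \<in> D" for \<theta>
    using k(2)[OF that] by simp
  have "h = (\<lambda>g\<in>carrier G. \<Sum>\<psi>\<in>k ` D. of_int (m (\<lambda>x. \<psi> (ex x))) * \<psi> g)"
  proof (rule ext_ex)
    fix x
    have "h (ex x) = (\<Sum>\<theta>\<in>D. of_int (m \<theta>) * \<theta> x)" using fun_cong[OF h_eq] .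
    also have "\<dots> = (\<Sum>\<theta>\<in>D. of_int (m (\<lambda>x. k \<theta> (ex x))) * k \<theta> (ex x))"
      by (intro sum.cong refl) (simp add: comp k(2))
    also have "\<dots> = (\<Sum>\<psi>\<in>k ` D. of_int (m (\<lambda>x. \<psi> (ex x))) * \<psi> (ex x))"
      using inj by (simp add: sum.reindex)
    finally show "h (ex x) =
      (\<lambda>g\<in>carrier G. \<Sum>\<psi>\<in>k ` D. of_int (m (\<lambda>x. \<psi> (ex x))) * \<psi> g) (ex x)"
      by simp
  qed (use h in auto)
  moreover have "finite (k ` D)" "k ` D \<subseteq> characters G T" using D k by auto
  ultimately show "h \<in> carrier (rep_ring G T)"
    unfolding rep_ring_def by (auto intro!: exI[of _ "k ` D"] exI[of _ "\<lambda>\<psi>. m (\<lambda>x. \<psi> (ex x))"])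
qed

text \<open>Every unitary character in the combination descends, so \<open>b\<close> is constant on
  the fibres of \<open>ex\<close>.\<close>

lemma rep_ring_lift:
  assumes "b \<in> lie_ring"
  obtains a where "a \<in> carrier (rep_ring G T)" "\<And>x. a (ex x) = b x"
proof -
  obtain C m where C: "finite C" "C \<subseteq> unitary_chars lattice"
    "b = (\<lambda>x. \<Sum>\<theta>\<in>C. of_int (m \<theta>) * \<theta> x)"
    using assms by (rule int_spanE)
  have const: "b x = b y" if "ex x = ex y" for x y
  proof -
    have "\<theta> x = \<theta> y" if "\<theta> \<in> C" for \<theta>
      using unitary_char_descends that C(2) \<open>ex x = ex y\<close> by (metis subsetD)
    then show ?thesis unfolding C(3) by (intro sum.cong) auto
  qed
  let ?a = "\<lambda>g\<in>carrier G. b (inv_into UNIV ex g)"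
  have a: "?a (ex x) = b x" for x
    using const[of "inv_into UNIV ex (ex x)" x] by (simp add: f_inv_into_f)
  then have "?a \<in> carrier (rep_ring G T)"
    unfolding rep_ring_iff using assms by simp
  then show ?thesis using a that by blast
qed

lemma rep_ring_ext:
  assumes "a \<in> carrier (rep_ring G T)" "b \<in> carrier (rep_ring G T)" "\<And>x. a (ex x) = b (ex x)"
  shows "a = b"
  using assms by (intro ext_ex) (auto simp: rep_ring_iff)

lemma rep_ring_mult_ex [simp]: "(a \<otimes>\<^bsub>rep_ring G T\<^esub> b) (ex x) = a (ex x) * b (ex x)"
  and rep_ring_add_ex [simp]: "(a \<oplus>\<^bsub>rep_ring G T\<^esub> b) (ex x) = a (ex x) + b (ex x)"
  and rep_ring_one_ex [simp]: "\<one>\<^bsub>rep_ring G T\<^esub> (ex x) = 1"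
  and rep_ring_zero_ex [simp]: "\<zero>\<^bsub>rep_ring G T\<^esub> (ex x) = 0"
  by (simp_all add: rep_ring_def)

text \<open>By \<open>rep_ring_ext\<close> the ring laws become pointwise laws for complex functions
  on the Lie algebra; negatives are obtained by lifting.\<close>

lemma rep_ring_cring: "cring (rep_ring G T)"
proof -
  let ?R = "rep_ring G T"
  have ext: "a \<otimes>\<^bsub>?R\<^esub> b \<in> extensional (carrier G)" "a \<oplus>\<^bsub>?R\<^esub> b \<in> extensional (carrier G)"
    "\<one>\<^bsub>?R\<^esub> \<in> extensional (carrier G)" "\<zero>\<^bsub>?R\<^esub> \<in> extensional (carrier G)" for a b
    by (simp_all add: rep_ring_def)
  have mult: "a \<otimes>\<^bsub>?R\<^esub> b \<in> carrier ?R" and add: "a \<oplus>\<^bsub>?R\<^esub> b \<in> carrier ?R"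
    if "a \<in> carrier ?R" "b \<in> carrier ?R" for a b
    using that ext by (auto simp: rep_ring_iff intro: char_ring_mult int_span_add)
  have one: "\<one>\<^bsub>?R\<^esub> \<in> carrier ?R" and zero: "\<zero>\<^bsub>?R\<^esub> \<in> carrier ?R"
    using ext by (auto simp: rep_ring_iff char_ring_one int_span_zero)
  have neg: "\<exists>b\<in>carrier ?R. b \<oplus>\<^bsub>?R\<^esub> a = \<zero>\<^bsub>?R\<^esub>" if a: "a \<in> carrier ?R" for a
  proof -
    have "(\<lambda>x. - a (ex x)) \<in> lie_ring" using a by (intro int_span_uminus) (simp add: rep_ring_iff)
    then obtain b where b: "b \<in> carrier ?R" "\<And>x. b (ex x) = - a (ex x)"
      using rep_ring_lift by metis
    then have "b \<oplus>\<^bsub>?R\<^esub> a = \<zero>\<^bsub>?R\<^esub>" using a by (intro rep_ring_ext add zero) auto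
    then show ?thesis using b(1) by blast
  qed
  show ?thesis
  proof (rule cringI)
    show "abelian_group ?R"
    proof (rule abelian_groupI)
      show "a \<oplus>\<^bsub>?R\<^esub> b \<oplus>\<^bsub>?R\<^esub> c = a \<oplus>\<^bsub>?R\<^esub> (b \<oplus>\<^bsub>?R\<^esub> c)"
        if "a \<in> carrier ?R" "b \<in> carrier ?R" "c \<in> carrier ?R" for a b c
        using that by (intro rep_ring_ext add) simp_all
      show "a \<oplus>\<^bsub>?R\<^esub> b = b \<oplus>\<^bsub>?R\<^esub> a" if "a \<in> carrier ?R" "b \<in> carrier ?R" for a b
        using that by (intro rep_ring_ext add) simp_all
      show "\<zero>\<^bsub>?R\<^esub> \<oplus>\<^bsub>?R\<^esub> a = a" if "a \<in> carrier ?R" for a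
        using that by (intro rep_ring_ext add zero) simp_all
    qed (fact add zero neg)+
    show "comm_monoid ?R"
    proof (rule comm_monoidI)
      show "a \<otimes>\<^bsub>?R\<^esub> b \<otimes>\<^bsub>?R\<^esub> c = a \<otimes>\<^bsub>?R\<^esub> (b \<otimes>\<^bsub>?R\<^esub> c)"
        if "a \<in> carrier ?R" "b \<in> carrier ?R" "c \<in> carrier ?R" for a b c
        using that by (intro rep_ring_ext mult) simp_all
      show "a \<otimes>\<^bsub>?R\<^esub> b = b \<otimes>\<^bsub>?R\<^esub> a" if "a \<in> carrier ?R" "b \<in> carrier ?R" for a b
        using that by (intro rep_ring_ext mult) simp_all
      show "\<one>\<^bsub>?R\<^esub> \<otimes>\<^bsub>?R\<^esub> a = a" if "a \<in> carrier ?R" for a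
        using that by (intro rep_ring_ext mult one) simp_all
    qed (fact mult one)+
    show "(a \<oplus>\<^bsub>?R\<^esub> b) \<otimes>\<^bsub>?R\<^esub> c = a \<otimes>\<^bsub>?R\<^esub> c \<oplus>\<^bsub>?R\<^esub> b \<otimes>\<^bsub>?R\<^esub> c"
      if "a \<in> carrier ?R" "b \<in> carrier ?R" "c \<in> carrier ?R" for a b c
      using that by (intro rep_ring_ext mult add) (auto simp: distrib_right)
  qed
qed

text \<open>The additive inverse is defined abstractly, so the value of a difference is read off
  from \<open>(a - b) + b = a\<close>.\<close>

lemma rep_ring_minus_ex:
  assumes "a \<in> carrier (rep_ring G T)" "b \<in> carrier (rep_ring G T)"
  shows "(a \<ominus>\<^bsub>rep_ring G T\<^esub> b) (ex x) = a (ex x) - b (ex x)"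
proof -
  interpret R: cring "rep_ring G T" by (rule rep_ring_cring)
  have "(a \<ominus>\<^bsub>rep_ring G T\<^esub> b) \<oplus>\<^bsub>rep_ring G T\<^esub> b = a"
    using assms by (simp add: a_minus_def R.a_assoc R.l_neg)
  then show ?thesis
    by (metis rep_ring_add_ex add_diff_cancel_right')
qed

lemma rep_ring_finsum_ex:
  assumes "\<And>i. i \<in> I \<Longrightarrow> a i \<in> carrier (rep_ring G T)"
  shows "finsum (rep_ring G T) a I (ex x) = (\<Sum>i\<in>I. a i (ex x))"
proof -
  interpret R: cring "rep_ring G T" by (rule rep_ring_cring)
  show ?thesis
    using assms by (induction I rule: infinite_finite_induct) (auto simp: Pi_def)
qed

lemma rep_ring_finprod_ex:
  assumes "\<And>i. i \<in> I \<Longrightarrow> a i \<in> carrier (rep_ring G T)"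
  shows "finprod (rep_ring G T) a I (ex x) = (\<Prod>i\<in>I. a i (ex x))"
proof -
  interpret R: cring "rep_ring G T" by (rule rep_ring_cring)
  show ?thesis
    using assms by (induction I rule: infinite_finite_induct) (auto simp: Pi_def)
qed

text \<open>Two preimages of a group element differ by a lattice vector, where the weight is
  integral, so the definite description has a unique value.\<close>

lemma weight_char_ex:
  assumes "\<alpha> \<in> weight_lattice G ex"
  shows "weight_char G ex \<alpha> (ex x) = cis (2 * pi * \<alpha> x)"
proof -
  have cis: "exp (2 * of_real pi * \<i> * of_real (\<alpha> y)) = cis (2 * pi * \<alpha> y)" for y
    by (simp add: cis_conv_exp mult_ac)
  have "cis (2 * pi * \<alpha> y) = cis (2 * pi * \<alpha> x)" if "ex y = ex x" for y
  proof -
    have "\<alpha> (y - x) \<in> \<int>" using that assms ex_eq_iff unfolding weight_lattice_def by blast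
    then have "cis (2 * pi * \<alpha> (y - x)) = 1" by (simp add: cis_2pi_eq_1_iff)
    moreover have "cis (2 * pi * \<alpha> y) = cis (2 * pi * \<alpha> (y - x)) * cis (2 * pi * \<alpha> x)"
      by (simp add: cis_mult blinfun.diff_right algebra_simps)
    ultimately show ?thesis by simp
  qed
  then have "(THE z. \<exists>y. ex y = ex x \<and> z = cis (2 * pi * \<alpha> y)) = cis (2 * pi * \<alpha> x)"
    by (intro the_equality) blast+
  then show ?thesis
    unfolding weight_char_def cis by simp
qed

lemma weight_char_unitary:
  "\<alpha> \<in> weight_lattice G ex \<Longrightarrow> (\<lambda>x. cis (2 * pi * \<alpha> x)) \<in> unitary_chars lattice"
  by (rule unitary_chars_cis) (simp add: weight_lattice_def)

lemma weight_char_in_rep_ring: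
  assumes "\<alpha> \<in> weight_lattice G ex"
  shows "weight_char G ex \<alpha> \<in> carrier (rep_ring G T)"
  unfolding rep_ring_iff weight_char_ex[OF assms]
  by (simp add: weight_char_def int_span_base weight_char_unitary assms)

text \<open>This is what lets the set of points with integral weight stand for the isotropy group of
  an edge.\<close>

lemma ex_in_weight_kernel:
  assumes "\<alpha> \<in> weight_lattice G ex"
  shows "ex x \<in> kernel G circle_group (weight_char G ex \<alpha>) \<longleftrightarrow> \<alpha> x \<in> \<int>"
  by (simp add: kernel_def circle_group_def weight_char_ex[OF assms] cis_2pi_eq_1_iff)

end

section \<open>Weights at the two ends of an edge\<close>

context torus_graph_action
begin

lemma char_poly_tau:
  assumes p: "p \<in> verts \<Gamma>"
  shows "char_poly (\<tau> p (ex x)) = (\<Prod>e\<in>out_arcs \<Gamma> p. [:- cis (2 * pi * \<alpha> e x), 1:])"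
proof -
  obtain es where es: "distinct es" "set es = out_arcs \<Gamma> p"
    "rep_iso_on (carrier G) d (\<tau> p) (direct_sum_rep (map \<rho> es))"
    using tau_iso[OF p] by blast
  have arcs: "e \<in> arcs \<Gamma>" if "e \<in> set es" for e using that es(2) by simp
  have len: "length es = d"
    using distinct_card[OF es(1)] valent[OF p] es(2) by simp
  have sum: "direct_sum_rep (map \<rho> es) (ex x) \<in> carrier_mat d d \<and>
    char_poly (direct_sum_rep (map \<rho> es) (ex x)) = (\<Prod>\<rho>\<leftarrow>map \<rho> es. [:- (\<rho> (ex x) $$ (0, 0)), 1:])"
    unfolding len[symmetric] length_map[of \<rho>, symmetric]
    by (rule char_poly_direct_sum_rep)
      (use arcs representation_carrier[OF rho_rep ex_closed] in \<open>auto simp del: One_nat_def\<close>)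
  have "char_poly (\<tau> p (ex x)) = (\<Prod>e\<leftarrow>es. [:- (\<rho> e (ex x) $$ (0, 0)), 1:])"
    using rep_iso_on_char_poly[OF es(3), of "ex x"] representation_carrier[OF tau_rep[OF p]] sum
    by (simp add: o_def)
  also have "\<dots> = (\<Prod>e\<leftarrow>es. [:- cis (2 * pi * \<alpha> e x), 1:])"
    using arcs by (intro arg_cong[where f = prod_list] map_cong refl)
      (simp add: rho_char weight_char_ex weight)
  also have "\<dots> = (\<Prod>e\<in>out_arcs \<Gamma> p. [:- cis (2 * pi * \<alpha> e x), 1:])"
    using es(1,2) by (simp add: prod.distinct_set_conv_list[symmetric])
  finally show ?thesis .
qed

text \<open>Duality of the edge representations gives inverse characters, so the sum of the two
  weights takes only integral values. A nonzero linear functional takes every real value, so the sum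
  is zero.\<close>

lemma weight_rev:
  assumes e: "e \<in> arcs \<Gamma>"
  shows "\<alpha> (rev e) = - \<alpha> e"
proof (rule ccontr)
  have rev_e: "rev e \<in> arcs \<Gamma>" using e by simp
  have int: "\<alpha> (rev e) x + \<alpha> e x \<in> \<int>" for x
  proof -
    let ?M = "\<rho> (rev e) (ex x)" and ?N = "dual_rep G (\<rho> e) (ex x)"
    have M: "?M \<in> carrier_mat 1 1" by (rule representation_carrier[OF rho_rep[OF rev_e]]) simp
    have N': "\<rho> e (ex (- x)) \<in> carrier_mat 1 1"
      by (rule representation_carrier[OF rho_rep[OF e]]) simp
    then have N: "?N \<in> carrier_mat 1 1" by (simp add: dual_rep_def ex_minus)
    have "char_poly ?M = char_poly ?N"
      by (rule rep_iso_on_char_poly[OF rho_rev[OF e] _ M N]) simp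
    then have "?M $$ (0, 0) = ?N $$ (0, 0)"
      unfolding char_poly_1x1[OF M] char_poly_1x1[OF N] by simp
    also have "\<dots> = \<rho> e (ex (- x)) $$ (0, 0)"
      using N' by (simp add: dual_rep_def ex_minus)
    finally have "cis (2 * pi * \<alpha> (rev e) x) = cis (2 * pi * \<alpha> e (- x))"
      by (simp add: rho_char e rev_e weight_char_ex weight)
    then have "cis (2 * pi * \<alpha> (rev e) x) * cis (2 * pi * \<alpha> e x) = 1"
      by (simp add: cis_mult blinfun.minus_right)
    then have "cis (2 * pi * (\<alpha> (rev e) x + \<alpha> e x)) = 1"
      by (simp add: cis_mult distrib_left)
    then show ?thesis by (simp add: cis_2pi_eq_1_iff)
  qed
  assume "\<alpha> (rev e) \<noteq> - \<alpha> e"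
  then have "\<alpha> (rev e) + \<alpha> e \<noteq> 0" by (simp add: eq_neg_iff_add_eq_0)
  then obtain x where x: "(\<alpha> (rev e) + \<alpha> e) x = 1" by (rule blinfun_nonzero_obtain)
  \<comment> \<open>Halving a vector of value 1 produces the value 1/2.\<close>
  have "(\<alpha> (rev e) + \<alpha> e) (x /\<^sub>R 2) \<in> \<int>" using int by (simp add: plus_blinfun.rep_eq)
  then have "(1 / 2 :: real) \<in> \<int>" by (simp add: blinfun.scaleR_right x)
  then show False by (auto elim!: Ints_cases)
qed

text \<open>On the isotropy group of \<open>e\<close> the characteristic polynomials of
  \<open>\<tau>\<close> at both ends agree. There \<open>e\<close> and \<open>rev e\<close> each
  contribute the root 1. This linear factor is cancelled between polynomials before evaluating at 1;
  evaluating first would only give 0 = 0.\<close>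

lemma weights_congruent:
  assumes e: "e \<in> arcs \<Gamma>" and x: "\<alpha> e x \<in> \<int>"
  shows "(\<Prod>e' | e' \<in> arcs \<Gamma> \<and> tail \<Gamma> e' = tail \<Gamma> e \<and> e' \<noteq> e. 1 - cis (2 * pi * \<alpha> e' x)) =
    (\<Prod>e' | e' \<in> arcs \<Gamma> \<and> tail \<Gamma> e' = tail \<Gamma> (rev e) \<and> e' \<noteq> rev e. 1 - cis (2 * pi * \<alpha> e' x))"
proof -
  let ?l = "\<lambda>e'. [:- cis (2 * pi * \<alpha> e' x), 1:]"
  have rev_e: "rev e \<in> arcs \<Gamma>" using e by simp
  have x': "\<alpha> (rev e) x \<in> \<int>" using x by (simp add: weight_rev[OF e] blinfun.minus_left)
  have split: "char_poly (\<tau> (tail \<Gamma> e') (ex x)) =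
      [:- 1, 1:] * (\<Prod>e''\<in>out_arcs \<Gamma> (tail \<Gamma> e') - {e'}. ?l e'')"
    if "e' \<in> arcs \<Gamma>" "\<alpha> e' x \<in> \<int>" for e'
  proof -
    have "char_poly (\<tau> (tail \<Gamma> e') (ex x)) = (\<Prod>e''\<in>out_arcs \<Gamma> (tail \<Gamma> e'). ?l e'')"
      using that by (intro char_poly_tau) simp
    also have "\<dots> = ?l e' * (\<Prod>e''\<in>out_arcs \<Gamma> (tail \<Gamma> e') - {e'}. ?l e'')"
      by (rule prod.remove) (use that in auto)
    finally show ?thesis using that(2) by (simp only: cis_2pi_eq_1_iff[THEN iffD2])
  qed
  have "char_poly (\<tau> (tail \<Gamma> e) (ex x)) = char_poly (\<tau> (tail \<Gamma> (rev e)) (ex x))"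
  proof (rule rep_iso_on_char_poly[where \<rho> = "\<tau> (tail \<Gamma> e)" and \<sigma> = "\<tau> (tail \<Gamma> (rev e))" and g = "ex x"])
    show "rep_iso_on (kernel G circle_group (weight_char G ex (\<alpha> e))) d
        (\<tau> (tail \<Gamma> e)) (\<tau> (tail \<Gamma> (rev e)))"
      using tau_edge[OF e] e by simp
    show "ex x \<in> kernel G circle_group (weight_char G ex (\<alpha> e))"
      using x by (simp add: ex_in_weight_kernel weight e)
  qed (auto intro!: representation_carrier[OF tau_rep] simp: e)
  then have "(\<Prod>e''\<in>out_arcs \<Gamma> (tail \<Gamma> e) - {e}. ?l e'') =
      (\<Prod>e''\<in>out_arcs \<Gamma> (tail \<Gamma> (rev e)) - {rev e}. ?l e'')"
    unfolding split[OF e x] split[OF rev_e x'] by (subst (asm) mult_cancel_left) simp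
  then have "poly (\<Prod>e''\<in>out_arcs \<Gamma> (tail \<Gamma> e) - {e}. ?l e'') 1 =
      poly (\<Prod>e''\<in>out_arcs \<Gamma> (tail \<Gamma> (rev e)) - {rev e}. ?l e'') 1"
    by (simp only:)
  then have "(\<Prod>e''\<in>out_arcs \<Gamma> (tail \<Gamma> e) - {e}. 1 - cis (2 * pi * \<alpha> e'' x)) =
      (\<Prod>e''\<in>out_arcs \<Gamma> (tail \<Gamma> (rev e)) - {rev e}. 1 - cis (2 * pi * \<alpha> e'' x))"
    by (simp add: poly_prod)
  then show ?thesis by (simp add: out_arcs_def set_diff_eq conj_assoc)
qed

end

text \<open>Passes from the group to its Lie algebra: linear independence becomes
  non-proportionality, and restrictions to isotropy groups become identities at points of integral
  weight.\<close>

lemma (in GKM_graph_action) weighted_graph: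
  assumes f: "f \<in> K_class G T ex \<Gamma> \<alpha>"
  shows "weighted_graph (integral_lattice G ex) (verts \<Gamma>) (arcs \<Gamma>) (tail \<Gamma>) rev \<alpha> (\<lambda>p x. f p (ex x))"
proof
  show "\<alpha> e1 \<noteq> c *\<^sub>R \<alpha> e2"
    if "e1 \<in> arcs \<Gamma>" "e2 \<in> arcs \<Gamma>" "e1 \<noteq> e2" "tail \<Gamma> e1 = tail \<Gamma> e2" for e1 e2 c
  proof
    assume eq: "\<alpha> e1 = c *\<^sub>R \<alpha> e2"
    have ne: "\<alpha> e1 \<noteq> \<alpha> e2" and indep: "independent {\<alpha> e1, \<alpha> e2}" using gkm[OF that] by auto
    have "\<alpha> e1 \<in> span {\<alpha> e2}" unfolding eq by (intro span_scale span_base) simp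
    moreover have "{\<alpha> e1, \<alpha> e2} - {\<alpha> e1} = {\<alpha> e2}" using ne by auto
    ultimately show False using indep unfolding dependent_def by auto
  qed
  show "(\<lambda>x. f p (ex x)) \<in> int_span (unitary_chars (integral_lattice G ex))" if "p \<in> verts \<Gamma>" for p
    using f that by (auto simp: K_class_def rep_ring_iff)
  show "f (tail \<Gamma> e) (ex x) = f (tail \<Gamma> (rev e)) (ex x)" if e: "e \<in> arcs \<Gamma>" and x: "\<alpha> e x \<in> \<int>" for e x
  proof -
    let ?S = "kernel G circle_group (weight_char G ex (\<alpha> e))"
    have "restrict (f (tail \<Gamma> e)) ?S (ex x) = restrict (f (head \<Gamma> e)) ?S (ex x)"
      using f e by (simp add: K_class_def)
    moreover have "ex x \<in> ?S" using x by (simp add: ex_in_weight_kernel weight e)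
    ultimately show ?thesis using e by simp
  qed
qed (use weight_rev weights_congruent weight_char_unitary weight weight_nonzero in auto)

section \<open>The character sum in the field of fractions\<close>

theorem theorem1p1:
  fixes G :: "('g, 'm) monoid_scheme"
    and T :: "'g topology"
    and ex :: "'v::real_normed_vector \<Rightarrow> 'g"
    and n d :: nat
    and \<Gamma> :: "('p, 'e) pre_digraph"
    and rev :: "'e \<Rightarrow> 'e"
    and \<alpha> :: "'e \<Rightarrow> 'v \<Rightarrow>\<^sub>L real"
    and \<rho> :: "'e \<Rightarrow> 'g \<Rightarrow> complex mat"
    and \<tau> :: "'p \<Rightarrow> 'g \<Rightarrow> complex mat"
    and f :: "'p \<Rightarrow> 'g \<Rightarrow> complex"
    and K :: "('k, 's) ring_scheme"
    and \<iota> :: "('g \<Rightarrow> complex) \<Rightarrow> 'k"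
  assumes "GKM_graph_action G T ex n \<Gamma> rev d \<alpha> \<rho> \<tau>"
    and "f \<in> K_class G T ex \<Gamma> \<alpha>"
    and "is_fraction_field (rep_ring G T) K \<iota>"
  shows "K_char G T ex \<Gamma> \<alpha> K \<iota> f \<in> \<iota> ` carrier (rep_ring G T)"
proof -
  interpret GKM_graph_action G T ex n \<Gamma> rev d \<alpha> \<rho> \<tau> by fact
  interpret W: weighted_graph "integral_lattice G ex" "verts \<Gamma>" "arcs \<Gamma>" "tail \<Gamma>" rev \<alpha> "\<lambda>p x. f p (ex x)"
    by (rule weighted_graph) fact
  define R where "R = rep_ring G T"
  interpret R: cring R unfolding R_def by (rule rep_ring_cring)
  have \<iota>: "field K" "\<iota> \<in> ring_hom R K" "inj_on \<iota> (carrier R)"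
    using assms(3) unfolding is_fraction_field_def R_def by auto
  interpret K: field K by (rule \<iota>(1))
  interpret \<iota>: ring_hom_cring R K \<iota>
    by unfold_locales (rule \<iota>(2))
  define c where "c e = \<one>\<^bsub>R\<^esub> \<ominus>\<^bsub>R\<^esub> weight_char G ex (\<alpha> e)" for e
  have c_in: "c e \<in> carrier R" if "e \<in> arcs \<Gamma>" for e
    unfolding c_def using weight_char_in_rep_ring[OF weight[OF that]] by (simp add: R_def[symmetric])
  have c_ex: "c e (ex x) = W.euler e x" if "e \<in> arcs \<Gamma>" for e x
    using rep_ring_minus_ex[OF R.one_closed[unfolded R_def] weight_char_in_rep_ring[OF weight[OF that]]]
    by (simp add: c_def R_def weight_char_ex[OF weight[OF that]] W.euler_def)
  have f_in: "f p \<in> carrier R" if "p \<in> verts \<Gamma>" for p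
    using assms(2) that by (auto simp: K_class_def R_def)
  have out: "W.out p = out_arcs \<Gamma> p" for p
    by (simp add: W.out_def out_arcs_def)
  \<comment> \<open>Without a regular point, the constants 1 and 0 would agree at all regular
    points, hence everywhere.\<close>
  obtain x0 where x0: "W.regular x0"
    using W.eq_if_eq_on_regular[OF char_ring_one int_span_zero] by fastforce
  have nonzero: "\<iota> a \<noteq> \<zero>\<^bsub>K\<^esub>" if "a \<in> carrier R" "a (ex x0) \<noteq> 0" for a
  proof
    assume "\<iota> a = \<zero>\<^bsub>K\<^esub>"
    then have "a = \<zero>\<^bsub>R\<^esub>" using inj_onD[OF \<iota>(3), of a "\<zero>\<^bsub>R\<^esub>"] that(1) by simp
    then show False using that(2) by (simp add: R_def)
  qed
  \<comment> \<open>No factor vanishes at the regular point \<open>x0\<close>, so its image in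
    \<open>K\<close> is nonzero and the inverses in \<open>K_char\<close> are genuine.\<close>
  have \<iota>c_in: "\<iota> (c e) \<in> carrier K" and \<iota>c_Unit: "\<iota> (c e) \<in> Units K" if "e \<in> arcs \<Gamma>" for e
    using nonzero[OF c_in[OF that]] c_in[OF that] x0 that
    by (auto simp: K.field_Units c_ex W.regular_def)
  \<comment> \<open>Numerator and denominator of the sum over the product of all oriented edges;
    pulled back along \<open>ex\<close> they become the two sides of
    \<open>W.numerator_divisible\<close>.\<close>
  let ?num = "\<Oplus>\<^bsub>R\<^esub>p\<in>verts \<Gamma>. f p \<otimes>\<^bsub>R\<^esub> (\<Otimes>\<^bsub>R\<^esub>e\<in>arcs \<Gamma> - out_arcs \<Gamma> p. c e)"
  let ?den = "\<Otimes>\<^bsub>R\<^esub>e\<in>arcs \<Gamma>. c e"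
  have rest_in: "(\<Otimes>\<^bsub>R\<^esub>e\<in>arcs \<Gamma> - out_arcs \<Gamma> p. c e) \<in> carrier R" for p
    by (intro R.finprod_closed) (auto intro: c_in)
  have num_in: "?num \<in> carrier R"
    by (intro R.finsum_closed) (auto intro!: R.m_closed f_in rest_in)
  have den_in: "?den \<in> carrier R"
    by (intro R.finprod_closed) (auto intro: c_in)
  have num_ex: "?num (ex x) =
      (\<Sum>p\<in>verts \<Gamma>. f p (ex x) * (\<Prod>e\<in>arcs \<Gamma> - W.out p. W.euler e x))" for x
  proof -
    have "(\<Otimes>\<^bsub>R\<^esub>e\<in>arcs \<Gamma> - out_arcs \<Gamma> p. c e) (ex x) = (\<Prod>e\<in>arcs \<Gamma> - W.out p. W.euler e x)" for p
      unfolding R_def out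
      by (subst rep_ring_finprod_ex) (auto intro!: prod.cong c_ex c_in[unfolded R_def])
    then show ?thesis
      unfolding R_def
      by (subst rep_ring_finsum_ex)
        (auto simp: R_def[symmetric] intro!: R.m_closed f_in rest_in, simp add: R_def)
  qed
  have den_ex: "?den (ex x) = (\<Prod>e\<in>arcs \<Gamma>. W.euler e x)" for x
    unfolding R_def by (subst rep_ring_finprod_ex) (auto intro!: prod.cong c_ex c_in[unfolded R_def])
  obtain B where B: "B \<in> W.char_ring"
    "\<And>x. (\<Sum>p\<in>verts \<Gamma>. f p (ex x) * (\<Prod>e\<in>arcs \<Gamma> - W.out p. W.euler e x)) =
      (\<Prod>e\<in>arcs \<Gamma>. W.euler e x) * B x"
    using W.numerator_divisible by blast
  obtain b where b: "b \<in> carrier R" "\<And>x. b (ex x) = B x"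
    using rep_ring_lift[OF B(1)] unfolding R_def by metis
  have num_eq: "?num = ?den \<otimes>\<^bsub>R\<^esub> b"
  proof (rule rep_ring_ext)
    show "?num \<in> carrier (rep_ring G T)" "?den \<otimes>\<^bsub>R\<^esub> b \<in> carrier (rep_ring G T)"
      using num_in den_in b(1) by (simp_all flip: R_def)
    show "?num (ex x) = (?den \<otimes>\<^bsub>R\<^esub> b) (ex x)" for x
    proof -
      have "(?den \<otimes>\<^bsub>R\<^esub> b) (ex x) = ?den (ex x) * b (ex x)" unfolding R_def by simp
      then show ?thesis unfolding num_ex den_ex b(2) B(2) by (rule sym)
    qed
  qed
  let ?term = "\<lambda>p. \<iota> (f p) \<otimes>\<^bsub>K\<^esub> (\<Otimes>\<^bsub>K\<^esub>e\<in>out_arcs \<Gamma> p. inv\<^bsub>K\<^esub> (\<iota> (c e)))"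
  have inv_in: "(\<Otimes>\<^bsub>K\<^esub>e\<in>out_arcs \<Gamma> p. inv\<^bsub>K\<^esub> (\<iota> (c e))) \<in> carrier K" for p
    by (intro K.finprod_closed) (auto intro!: K.Units_inv_closed \<iota>c_Unit)
  have term_in: "?term p \<in> carrier K" if "p \<in> verts \<Gamma>" for p
    by (intro K.m_closed inv_in \<iota>.hom_closed f_in that)
  have \<iota>den: "\<iota> ?den = (\<Otimes>\<^bsub>K\<^esub>e\<in>arcs \<Gamma>. \<iota> (c e))"
    by (subst \<iota>.hom_finprod) (auto intro: c_in simp: o_def)
  \<comment> \<open>In the full denominator the factors of the edges leaving \<open>p\<close> cancel
    the inverses in the local term, and the other factors remain.\<close>
  have term_eq: "?term p \<otimes>\<^bsub>K\<^esub> \<iota> ?den = \<iota> (f p \<otimes>\<^bsub>R\<^esub> (\<Otimes>\<^bsub>R\<^esub>e\<in>arcs \<Gamma> - out_arcs \<Gamma> p. c e))"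
    if p: "p \<in> verts \<Gamma>" for p
  proof -
    let ?I = "\<Otimes>\<^bsub>K\<^esub>e\<in>out_arcs \<Gamma> p. inv\<^bsub>K\<^esub> (\<iota> (c e))"
    let ?P = "\<Otimes>\<^bsub>K\<^esub>e\<in>out_arcs \<Gamma> p. \<iota> (c e)"
    let ?Q = "\<Otimes>\<^bsub>K\<^esub>e\<in>arcs \<Gamma> - out_arcs \<Gamma> p. \<iota> (c e)"
    have in_K: "?P \<in> carrier K" "?Q \<in> carrier K" "\<iota> (f p) \<in> carrier K"
      using f_in[OF p] by (auto intro!: K.finprod_closed \<iota>c_in)
    have "?I \<otimes>\<^bsub>K\<^esub> ?P = (\<Otimes>\<^bsub>K\<^esub>e\<in>out_arcs \<Gamma> p. inv\<^bsub>K\<^esub> (\<iota> (c e)) \<otimes>\<^bsub>K\<^esub> \<iota> (c e))"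
      by (rule K.finprod_multf[symmetric]) (auto intro!: K.Units_inv_closed \<iota>c_Unit \<iota>c_in)
    also have "\<dots> = \<one>\<^bsub>K\<^esub>"
      by (rule K.finprod_one_eqI) (auto intro!: K.Units_l_inv \<iota>c_Unit)
    finally have IP: "?I \<otimes>\<^bsub>K\<^esub> ?P = \<one>\<^bsub>K\<^esub>" .
    have "\<iota> ?den = (\<Otimes>\<^bsub>K\<^esub>e\<in>out_arcs \<Gamma> p \<union> (arcs \<Gamma> - out_arcs \<Gamma> p). \<iota> (c e))"
      unfolding \<iota>den by (intro arg_cong[where f = "finprod K _"]) auto
    also have "\<dots> = ?P \<otimes>\<^bsub>K\<^esub> ?Q"
      by (rule K.finprod_Un_disjoint) (auto intro: \<iota>c_in)
    finally have "?term p \<otimes>\<^bsub>K\<^esub> \<iota> ?den = \<iota> (f p) \<otimes>\<^bsub>K\<^esub> (?I \<otimes>\<^bsub>K\<^esub> ?P \<otimes>\<^bsub>K\<^esub> ?Q)"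
      using in_K inv_in by (simp add: K.m_assoc)
    also have "\<dots> = \<iota> (f p) \<otimes>\<^bsub>K\<^esub> ?Q" using IP in_K by simp
    also have "?Q = \<iota> (\<Otimes>\<^bsub>R\<^esub>e\<in>arcs \<Gamma> - out_arcs \<Gamma> p. c e)"
      by (subst \<iota>.hom_finprod) (auto intro: c_in simp: o_def)
    finally show ?thesis using f_in[OF p] rest_in by simp
  qed
  have K_char: "K_char G T ex \<Gamma> \<alpha> K \<iota> f = (\<Oplus>\<^bsub>K\<^esub>p\<in>verts \<Gamma>. ?term p)"
    unfolding K_char_def c_def R_def ..
  have K_char_in: "K_char G T ex \<Gamma> \<alpha> K \<iota> f \<in> carrier K"
    unfolding K_char by (intro K.finsum_closed) (auto intro: term_in)
  have "K_char G T ex \<Gamma> \<alpha> K \<iota> f \<otimes>\<^bsub>K\<^esub> \<iota> ?den = (\<Oplus>\<^bsub>K\<^esub>p\<in>verts \<Gamma>. ?term p \<otimes>\<^bsub>K\<^esub> \<iota> ?den)"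
    unfolding K_char by (rule K.finsum_ldistr) (auto intro: term_in den_in)
  also have "\<dots> = (\<Oplus>\<^bsub>K\<^esub>p\<in>verts \<Gamma>. \<iota> (f p \<otimes>\<^bsub>R\<^esub> (\<Otimes>\<^bsub>R\<^esub>e\<in>arcs \<Gamma> - out_arcs \<Gamma> p. c e)))"
    by (intro K.finsum_cong') (auto simp: term_eq intro!: K.m_closed f_in rest_in \<iota>.hom_closed)
  also have "\<dots> = \<iota> ?num"
    by (subst \<iota>.hom_finsum) (auto intro!: R.m_closed f_in rest_in simp: o_def)
  also have "\<dots> = \<iota> b \<otimes>\<^bsub>K\<^esub> \<iota> ?den"
    unfolding num_eq using den_in b(1) by (simp add: K.m_comm)
  finally have eq: "K_char G T ex \<Gamma> \<alpha> K \<iota> f \<otimes>\<^bsub>K\<^esub> \<iota> ?den = \<iota> b \<otimes>\<^bsub>K\<^esub> \<iota> ?den" .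
  \<comment> \<open>The denominator is nonzero at \<open>x0\<close>, so it can be cancelled in
    \<open>K\<close>.\<close>
  have "\<iota> ?den \<noteq> \<zero>\<^bsub>K\<^esub>"
    using W.euler_prod_nonzero[OF x0 subset_refl] den_ex by (intro nonzero den_in) simp
  then have "K_char G T ex \<Gamma> \<alpha> K \<iota> f = \<iota> b"
    using eq K.m_rcancel[OF _ \<iota>.hom_closed[OF den_in] K_char_in \<iota>.hom_closed[OF b(1)]] by blast
  then show ?thesis using b(1) by (auto simp: R_def)
qed

end
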